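(* Let $X$ be a bounded integer-valued random variable with at least two values and mean $0$. Let $\sigma$ be its standard deviation, $\mu_3=\mathbf{E}X^3$ its third central moment, $b$ its span, and $a$ a shift of $X$. For integers $c$ put \[ L(c) = \frac{((-c)\bmod b) - (c\bmod b)}{\sigma} - \frac{\mu_3}{3\sigma^3}. \] Then for positive integers $n$, \[ T_n = \frac{L(na)}{\sqrt{2\pi n}} + E, \qquad E = E(n) = o(1/\sqrt n)\quad (n\to\infty). \]
   Context: A value of $X$ is an integer $x$ with $\mathbf{Pr}(X=x)>0$. The span of $X$ is the largest integer $b$ such that all values of $X$ lie in a single congruence class modulo $b$; an integer $a$ representing this congruence class is called a shift of $X$ (it is well defined only modulo $b$). For an integer $x$, $x \bmod b$ denotes the unique integer in $[0,b)$ congruent to $x$ modulo $b$. $X[n]$ denotes the sum of $n$ independent copies of $X$. For a random variable $Z$ with mean $\mu$, its tilt is $T(Z)=\mathbf{Pr}(Z>\mu)-\mathbf{Pr}(Z<\mu)$, and $T_n = T(X[n])$; since $X$ has mean $0$, $T_n=\mathbf{Pr}(X[n]>0)-\mathbf{Pr}(X[n]<0)$. *)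

theory Defs
  imports "HOL-Probability.Probability" "HOL-Number_Theory.Cong" "HOL-Library.Landau_Symbols"
begin

definition rv_values :: "'a measure \<Rightarrow> ('a \<Rightarrow> int) \<Rightarrow> int set" where
  "rv_values M X = {x. measure M {\<omega> \<in> space M. X \<omega> = x} > 0}"

(* The greatest element exists as soon as X has at least two values. *)
definition rv_span :: "'a measure \<Rightarrow> ('a \<Rightarrow> int) \<Rightarrow> int" where
  "rv_span M X = (GREATEST b. \<exists>a. \<forall>x\<in>rv_values M X. [x = a] (mod b))"

definition is_shift :: "'a measure \<Rightarrow> ('a \<Rightarrow> int) \<Rightarrow> int \<Rightarrow> bool" where
  "is_shift M X a \<longleftrightarrow> (\<forall>x\<in>rv_values M X. [x = a] (mod rv_span M X))"

definition tilt :: "'a measure \<Rightarrow> ('a \<Rightarrow> real) \<Rightarrow> real" where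
  "tilt M Z =
     measure M {\<omega> \<in> space M. Z \<omega> > integral\<^sup>L M Z} - measure M {\<omega> \<in> space M. Z \<omega> < integral\<^sup>L M Z}"

(* X[n] is realised on the n-fold product of M, whose coordinates are independent; its law
   is that of the sum of any n independent copies of X. *)
definition tilt_sum :: "'a measure \<Rightarrow> ('a \<Rightarrow> int) \<Rightarrow> nat \<Rightarrow> real" where
  "tilt_sum M X n =
     tilt (\<Pi>\<^sub>M i\<in>{..<n}. M) (\<lambda>\<omega>. real_of_int (\<Sum>i<n. X (\<omega> i)))"

definition L_term :: "int \<Rightarrow> real \<Rightarrow> real \<Rightarrow> int \<Rightarrow> real" where
  "L_term b \<sigma> \<mu>3 c =
     real_of_int (((- c) mod b) - (c mod b)) / \<sigma> - \<mu>3 / (3 * \<sigma> ^ 3)"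

end

theory Submission
  imports Defs "HOL-Real_Asymp.Real_Asymp"
begin

text \<open>
  The tilt is the mean of \<open>sgn\<close> over the law of \<open>X[n]\<close>, which lives on the coset \<open>na + b\<int>\<close>. On that
  coset \<open>sgn\<close> is the average of two threshold functions with values \<open>\<plusminus>1\<close>: one jumps at the least
  nonnegative point \<open>c\<^sub>1 = na mod b\<close>, the other at the least positive point
  \<open>c\<^sub>2 = b - (-na mod b)\<close> (\<open>sgn_eq_threshold_mean\<close>). The Dirichlet kernel writes a threshold
  function at a lattice point \<open>c\<close> as a Fourier integral over one period, so with \<open>\<phi>\<close> the
  characteristic function of \<open>X\<close> and \<open>d = b/2 - c\<close> its mean under \<open>X[n]\<close> is exactly
  \<open>I d n = b/(2\<pi>) \<integral> Im (\<phi>(t)^n e^(itd)) / sin(bt/2) dt\<close> over \<open>\<bar>t\<bar> \<le> \<pi>/b\<close>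
  (\<open>lattice_threshold_inversion\<close>). The imaginary part vanishes at \<open>t = 0\<close>, which makes the singularity
  of the kernel harmless.

  Substituting \<open>t = w/(\<sigma>\<surd>n)\<close>, the integrand tends to
  \<open>(2/b) (d - \<mu>\<^sub>3 w\<^sup>2/(6\<sigma>\<^sup>2)) e^(-w\<^sup>2/2)\<close>: the modulus of \<open>\<phi>^n\<close> gives the Gaussian, and since \<open>X\<close> is
  centred its argument is of third order, \<open>-\<mu>\<^sub>3 t\<^sup>3/6\<close> per summand; as \<open>nt\<^sup>2\<close> is of order one,
  \<open>n\<close> summands give a multiple of \<open>t\<close>, comparable with the correction \<open>td\<close>. The limit may
  be taken under the integral because maximality of the span forces \<open>\<bar>\<phi>\<bar> < 1\<close> away from \<open>0\<close> on the whole period, hence a Gaussian bound there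
  (\<open>norm_cf_gaussian_bound\<close>, \<open>inversion_integrand_bound\<close>). Gaussian moments then give
  \<open>\<surd>n I d n \<longlonglongrightarrow> (2d/\<sigma> - \<mu>\<^sub>3/(3\<sigma>\<^sup>3)) / \<surd>(2\<pi>)\<close> for each fixed \<open>d\<close> (\<open>inversion_integral_limit\<close>).

  Finally \<open>d\<^sub>1 + d\<^sub>2 = b - c\<^sub>1 - c\<^sub>2 = (-na mod b) - (na mod b)\<close>, so the average of the two limits is
  \<open>L(na)/\<surd>(2\<pi>)\<close>. The shifts vary with \<open>n\<close>, but only through finitely many values, so the convergence
  for fixed \<open>d\<close> suffices.
\<close>

section \<open>Elementary estimates and limits\<close>

lemma sin_sub_self_bound: "\<bar>sin x - x\<bar> \<le> \<bar>x\<bar> ^ 3 / 6" for x :: real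
  using Maclaurin_sin_bound[of x 3]
  by (simp add: numeral_3_eq_3 sin_coeff_def fact_numeral divide_simps)

text \<open>
  A weak form of Jordan's inequality; any positive constant serves to control the Dirichlet kernel.
\<close>

lemma abs_sin_ge_third: "\<bar>x\<bar> / 3 \<le> \<bar>sin x\<bar>" if "\<bar>x\<bar> \<le> pi / 2" for x :: real
proof -
  have "\<bar>x\<bar> \<le> 2" using that pi_less_4 by linarith
  then have "x\<^sup>2 \<le> 2\<^sup>2" by (metis abs_le_square_iff abs_numeral)
  then have "\<bar>x\<bar> * x\<^sup>2 \<le> \<bar>x\<bar> * 4" by (intro mult_left_mono) auto
  then have "\<bar>x\<bar> ^ 3 \<le> 4 * \<bar>x\<bar>" by (simp add: power3_eq_cube power2_eq_square mult.assoc)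
  then show ?thesis using sin_sub_self_bound[of x] by linarith
qed

lemma cos_defect_limit: "((\<lambda>t. (1 - cos (t * z)) / t\<^sup>2) \<longlongrightarrow> z\<^sup>2 / 2) (at 0)" for z :: real
proof (cases "z = 0")
  case False
  then have "z < 0 \<or> z > 0" by auto
  then show ?thesis
    by (elim disjE; real_asymp simp: power2_eq_square)
qed auto

lemma sin_cubic_limit: "((\<lambda>t. (sin (t * z) - t * z) / t ^ 3) \<longlongrightarrow> - (z ^ 3) / 6) (at 0)" for z :: real
proof (cases "z = 0")
  case False
  then have "z < 0 \<or> z > 0" by auto
  then show ?thesis
    by (elim disjE; real_asymp simp: power2_eq_square power3_eq_cube)
qed auto

text \<open>
  Only one factor needs to contribute its imaginary part. Applied to a characteristic function, whose
  imaginary part is cubic at the origin, this keeps the cancellation that the bound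
  \<open>\<bar>Im z\<bar> \<le> norm z\<close> would lose.
\<close>

lemma abs_Im_power_le: "\<bar>Im (z ^ n)\<bar> \<le> real n * \<bar>Im z\<bar> * norm z ^ (n - 1)" for z :: complex
proof (induction n)
  case (Suc n)
  have "\<bar>Im (z ^ Suc n)\<bar> \<le> \<bar>Re z * Im (z ^ n)\<bar> + \<bar>Im z * Re (z ^ n)\<bar>"
    by simp
  also have "\<dots> \<le> norm z * (real n * \<bar>Im z\<bar> * norm z ^ (n - 1)) + \<bar>Im z\<bar> * norm z ^ n"
    unfolding abs_mult using Suc.IH abs_Re_le_cmod[of z] abs_Re_le_cmod[of "z ^ n"]
    by (intro add_mono mult_mono) (auto simp: norm_power)
  also have "\<dots> = real (Suc n) * \<bar>Im z\<bar> * norm z ^ (Suc n - 1)"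
    by (cases n) (auto simp: algebra_simps)
  finally show ?case .
qed simp

text \<open>
  Replaces an equivalence \<open>f x \<sim> x\<close> by an exact factorisation along \<open>X\<close>, including the indices where
  \<open>X\<close> vanishes and the quotient \<open>f (X i) / X i\<close> carries no information.
\<close>

lemma factor_through_ratio:
  fixes f :: "real \<Rightarrow> real"
  assumes ratio: "((\<lambda>x. f x / x) \<longlongrightarrow> 1) (at 0)" and "f 0 = 0" and X: "(X \<longlongrightarrow> 0) F"
  obtains r where "\<And>i. f (X i) = X i * r i" and "(r \<longlongrightarrow> 1) F"
proof
  define g where "g x = (if x = 0 then 1 else f x / x)" for x
  show "f (X i) = X i * g (X i)" for i using \<open>f 0 = 0\<close> by (simp add: g_def)
  have "(g \<longlongrightarrow> 1) (at 0)"
    by (rule Lim_transform_eventually[OF ratio]) (auto simp: g_def eventually_at_filter)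
  then have "isCont g 0" by (simp add: isCont_def g_def)
  from isCont_tendsto_compose[OF this X] show "((\<lambda>i. g (X i)) \<longlongrightarrow> 1) F" by (simp add: g_def)
qed

lemma one_plus_over_n_power_limit:
  fixes a :: "nat \<Rightarrow> real"
  assumes "(\<lambda>n. real n * a n) \<longlonglongrightarrow> L"
  shows "(\<lambda>n. (1 + a n) ^ n) \<longlonglongrightarrow> exp L"
proof -
  have "(\<lambda>n. inverse (real n) * (real n * a n)) \<longlonglongrightarrow> 0 * L"
    by (intro tendsto_mult assms lim_inverse_n)
  moreover have "\<forall>\<^sub>F n in sequentially. inverse (real n) * (real n * a n) = a n"
    using eventually_gt_at_top[of 0] by eventually_elim auto
  ultimately have a0: "a \<longlonglongrightarrow> 0" by (simp add: filterlim_cong)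
  have "((\<lambda>x::real. ln (1 + x) / x) \<longlongrightarrow> 1) (at 0)" by real_asymp
  then obtain r where r: "\<And>n. ln (1 + a n) = a n * r n" "r \<longlonglongrightarrow> 1"
    by (rule factor_through_ratio[OF _ _ a0]) auto
  have "(\<lambda>n. exp (real n * a n * r n)) \<longlonglongrightarrow> exp (L * 1)"
    by (intro tendsto_intros assms r)
  moreover have "\<forall>\<^sub>F n in sequentially. a n > -1" using a0 by (rule order_tendstoD) simp
  then have "\<forall>\<^sub>F n in sequentially. exp (real n * a n * r n) = (1 + a n) ^ n"
  proof eventually_elim
    case (elim n)
    have "exp (real n * a n * r n) = exp (real n * ln (1 + a n))" by (simp add: r mult.assoc)
    then show ?case using elim by (simp add: exp_of_nat_mult)
  qed
  ultimately show ?thesis by (simp add: filterlim_cong)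
qed

text \<open>
  Pointwise convergence over a finite parameter set is uniform, so the parameter may depend on \<open>n\<close>.
\<close>

lemma tendsto_selection_finite:
  fixes G :: "'a \<Rightarrow> nat \<Rightarrow> real"
  assumes "finite D" and "\<And>d. d \<in> D \<Longrightarrow> G d \<longlonglongrightarrow> 0" and "\<And>n. s n \<in> D"
  shows "(\<lambda>n. G (s n) n) \<longlonglongrightarrow> 0"
proof (rule tendstoI)
  fix e :: real assume "e > 0"
  have "\<forall>\<^sub>F n in sequentially. \<forall>d\<in>D. dist (G d n) 0 < e"
    by (intro eventually_ball_finite assms(1) ballI tendstoD assms(2) \<open>e > 0\<close>)
  then show "\<forall>\<^sub>F n in sequentially. dist (G (s n) n) 0 < e"
    by eventually_elim (use assms(3) in blast)
qed

section \<open>The Dirichlet kernel and lattice thresholds\<close>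

text \<open>
  Raising \<open>k\<close> by one adds \<open>2 cos ((k+1) b t)\<close> to the kernel, whose integral over a full period is zero,
  so the value stays that of \<open>k = 0\<close>, the length of the period. The identities fail at \<open>t = 0\<close>, where
  the quotient is \<open>0/0 = 0\<close>; hence the passage through almost everywhere.
\<close>

lemma dirichlet_kernel_integral_nonneg:
  fixes b :: real and k :: nat
  assumes b: "b > 0"
  shows "has_bochner_integral lborel
     (\<lambda>t. sin ((real k + 1/2) * (b * t)) / sin (b * t / 2) * indicator {- (pi / b)..pi / b} t) (2 * pi / b)"
proof (induction k)
  case 0
  have "has_bochner_integral lborel (\<lambda>t. 1 * indicator {- (pi / b)..pi / b} t :: real) (pi / b - (- (pi / b)))"
    by (rule has_bochner_integral_FTC_Icc_real) (use b in \<open>auto intro!: derivative_eq_intros\<close>)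
  moreover have "AE t in lborel. 1 * indicator {- (pi / b)..pi / b} t
      = sin ((real 0 + 1/2) * (b * t)) / sin (b * t / 2) * indicator {- (pi / b)..pi / b} t"
    using AE_lborel_singleton[of 0]
  proof eventually_elim
    case (elim t)
    show ?case
    proof (cases "t \<in> {- (pi / b)..pi / b}")
      case True
      then have "\<bar>b * t / 2\<bar> \<le> pi / 2" using b by (auto simp: abs_le_iff field_simps)
      then have "sin (b * t / 2) \<noteq> 0" using abs_sin_ge_third[of "b * t / 2"] elim b by auto
      then show ?thesis by simp
    qed auto
  qed
  ultimately show ?case
    by (subst has_bochner_integral_cong_AE[symmetric]) (auto simp: field_simps)
next
  case (Suc k)
  have "has_bochner_integral lborel (\<lambda>t. 2 * cos (real (Suc k) * (b * t)) * indicator {- (pi / b)..pi / b} t :: real)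
     (2 * sin (real (Suc k) * (b * (pi / b))) / (Suc k * b) - 2 * sin (real (Suc k) * (b * (- (pi / b)))) / (Suc k * b))"
    by (rule has_bochner_integral_FTC_Icc_real)
       (use b in \<open>auto intro!: derivative_eq_intros continuous_intros simp del: of_nat_Suc simp: field_simps\<close>)
  moreover have "sin (real (Suc k) * (b * (pi / b))) = 0"
    using b sin_npi[of "Suc k"] by (simp del: of_nat_Suc sin_npi)
  ultimately have "has_bochner_integral lborel (\<lambda>t. 2 * cos (real (Suc k) * (b * t)) * indicator {- (pi / b)..pi / b} t :: real) 0"
    by (simp del: of_nat_Suc)
  from has_bochner_integral_add[OF Suc.IH this]
  have *: "has_bochner_integral lborel
    (\<lambda>t. sin ((real k + 1/2) * (b * t)) / sin (b * t / 2) * indicator {- (pi / b)..pi / b} t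
       + 2 * cos (real (Suc k) * (b * t)) * indicator {- (pi / b)..pi / b} t) (2 * pi / b)" by simp
  moreover have "AE t in lborel. sin ((real k + 1/2) * (b * t)) / sin (b * t / 2) * indicator {- (pi / b)..pi / b} t
       + 2 * cos (real (Suc k) * (b * t)) * indicator {- (pi / b)..pi / b} t
      = sin ((real (Suc k) + 1/2) * (b * t)) / sin (b * t / 2) * indicator {- (pi / b)..pi / b} t"
    using AE_lborel_singleton[of 0]
  proof eventually_elim
    case (elim t)
    show ?case
    proof (cases "t \<in> {- (pi / b)..pi / b}")
      case True
      then have "\<bar>b * t / 2\<bar> \<le> pi / 2" using b by (auto simp: abs_le_iff field_simps)
      then have nz: "sin (b * t / 2) \<noteq> 0" using abs_sin_ge_third[of "b * t / 2"] elim b by auto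
      define y where "y = real (Suc k) * (b * t)"
      have e: "(real k + 1/2) * (b * t) = y - b * t / 2" "(real (Suc k) + 1/2) * (b * t) = y + b * t / 2"
        by (auto simp: y_def algebra_simps)
      have "sin (y - b * t / 2) / sin (b * t / 2) + 2 * cos y = sin (y + b * t / 2) / sin (b * t / 2)"
        unfolding sin_add sin_diff using nz by (simp add: add_divide_distrib diff_divide_distrib)
      then show ?thesis unfolding e y_def[symmetric] using True by simp
    qed auto
  qed
  ultimately show ?case
    by (subst has_bochner_integral_cong_AE[symmetric]) (auto simp: field_simps)
qed

text \<open>
  The kernel is odd under \<open>k \<mapsto> -k - 1\<close>, so it detects the sign of the half-integer \<open>k + 1/2\<close>.
\<close>

lemma dirichlet_kernel_integral:
  fixes b :: real and k :: int
  assumes b: "b > 0"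
  shows "has_bochner_integral lborel
     (\<lambda>t. sin ((real_of_int k + 1/2) * (b * t)) / sin (b * t / 2) * indicator {- (pi / b)..pi / b} t)
     (2 * pi / b * (if 0 \<le> k then 1 else -1))"
proof (cases "0 \<le> k")
  case True
  then show ?thesis using dirichlet_kernel_integral_nonneg[OF b, of "nat k"] by simp
next
  case False
  define m where "m = nat (- k - 1)"
  have m: "real m + 1/2 = - (real_of_int k + 1/2)" using False by (simp add: m_def)
  have "has_bochner_integral lborel
     (\<lambda>t. - (sin ((real m + 1/2) * (b * t)) / sin (b * t / 2) * indicator {- (pi / b)..pi / b} t)) (- (2 * pi / b))"
    by (intro has_bochner_integral_minus dirichlet_kernel_integral_nonneg b)
  then show ?thesis unfolding m mult_minus_left sin_minus using False by simp
qed

text \<open>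
  On the coset \<open>x = c + bk\<close> the phases combine to \<open>tx + t(b/2 - c) = (k + 1/2)bt\<close>, the argument in
  the Dirichlet kernel, and \<open>c \<le> x\<close> means \<open>k \<ge> 0\<close>.
\<close>

lemma lattice_threshold_inversion:
  fixes q :: "int \<Rightarrow> real" and f :: "real \<Rightarrow> complex"
  assumes "finite W" and b: "b > 0" and lattice: "\<And>x. x \<in> W \<Longrightarrow> [x = c] (mod b)"
    and f: "\<And>t. f t = (\<Sum>x\<in>W. of_real (q x) * cis (t * of_int x))"
  shows "(\<Sum>x\<in>W. q x * (if c \<le> x then 1 else -1))
    = b / (2 * pi) * (\<integral>t. Im (f t * cis (t * (b / 2 - c))) / sin (b * t / 2)
        * indicator {- (pi / b)..pi / b} t \<partial>lborel)"
proof -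
  define k where "k x = (x - c) div b" for x
  have xk: "x = c + b * k x" if "x \<in> W" for x
    using lattice[OF that] by (simp add: k_def cong_iff_dvd_diff)
  have "has_bochner_integral lborel
      (\<lambda>t. \<Sum>x\<in>W. q x * (sin ((real_of_int (k x) + 1/2) * (b * t)) / sin (b * t / 2) * indicator {- (pi / b)..pi / b} t))
      (\<Sum>x\<in>W. q x * (2 * pi / b * (if 0 \<le> k x then 1 else -1)))"
    using b by (intro has_bochner_integral_sum has_bochner_integral_mult_right dirichlet_kernel_integral) auto
  moreover have "(\<lambda>t::real. \<Sum>x\<in>W. q x * (sin ((real_of_int (k x) + 1/2) * (b * t)) / sin (b * t / 2) * indicator {- (pi / b)..pi / b} t))
     = (\<lambda>t::real. Im (f t * cis (t * (b / 2 - c))) / sin (b * t / 2) * indicator {- (pi / b)..pi / b} t)"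
  proof
    fix t :: real
    have eq: "Im (f t * cis (t * (b / 2 - c))) = (\<Sum>x\<in>W. q x * sin ((real_of_int (k x) + 1/2) * (b * t)))"
      unfolding f sum_distrib_right Im_sum mult.assoc cis_mult
    proof (rule sum.cong[OF refl])
      fix x assume "x \<in> W"
      then have "real_of_int x = c + b * k x" using xk by (metis of_int_add of_int_mult)
      then show "Im (of_real (q x) * cis (t * real_of_int x + t * (b / 2 - c))) = q x * sin ((real_of_int (k x) + 1/2) * (b * t))"
        by (simp add: algebra_simps)
    qed
    show "(\<Sum>x\<in>W. q x * (sin ((real_of_int (k x) + 1/2) * (b * t)) / sin (b * t / 2) * indicator {- (pi / b)..pi / b} t))
       = Im (f t * cis (t * (b / 2 - c))) / sin (b * t / 2) * indicator {- (pi / b)..pi / b} t"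
      unfolding eq sum_distrib_right sum_divide_distrib by (rule sum.cong) simp_all
  qed
  ultimately have "(\<integral>t. Im (f t * cis (t * (b / 2 - c))) / sin (b * t / 2)
        * indicator {- (pi / b)..pi / b} t \<partial>lborel) = (\<Sum>x\<in>W. q x * (2 * pi / b * (if 0 \<le> k x then 1 else -1)))"
    by (simp add: has_bochner_integral_iff)
  moreover have "(0 \<le> k x) = (c \<le> x)" for x
    using b by (simp add: k_def pos_imp_zdiv_nonneg_iff)
  ultimately show ?thesis using b by (simp add: sum_distrib_left mult_ac)
qed

section \<open>Characteristic functions of finitely supported integer laws\<close>

locale finite_law =
  fixes V :: "int set" and p :: "int \<Rightarrow> real"
  assumes fin: "finite V" and pos: "\<And>x. x \<in> V \<Longrightarrow> p x > 0" and total: "(\<Sum>x\<in>V. p x) = 1"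
begin

definition cf :: "real \<Rightarrow> complex" where
  "cf t = (\<Sum>x\<in>V. of_real (p x) * cis (t * of_int x))"

lemma Re_cf: "Re (cf t) = (\<Sum>x\<in>V. p x * cos (t * x))"
  and Im_cf: "Im (cf t) = (\<Sum>x\<in>V. p x * sin (t * x))"
  by (simp_all add: cf_def)

lemma continuous_on_cf [continuous_intros]: "continuous_on A f \<Longrightarrow> continuous_on A (\<lambda>t. cf (f t))"
  unfolding cf_def by (intro continuous_intros)

lemma isCont_cf: "isCont cf t"
  using continuous_on_cf[of UNIV "\<lambda>t. t"] by (simp add: continuous_on_eq_continuous_at)

lemma cf_0: "cf 0 = 1"
  using total by (simp add: complex_eq_iff Re_cf Im_cf)

lemma norm_cf_le_1: "norm (cf t) \<le> 1"
proof -
  have "norm (cf t) \<le> (\<Sum>x\<in>V. norm (of_real (p x) * cis (t * of_int x)))"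
    unfolding cf_def by (rule norm_sum)
  also have "\<dots> = (\<Sum>x\<in>V. p x)"
    by (intro sum.cong) (auto simp: norm_mult dest: pos less_imp_le)
  finally show ?thesis using total by simp
qed

text \<open>
  The squared modulus is the characteristic function of the symmetrised law, the difference of two
  independent copies. Every summand on the right is nonnegative, so \<open>\<bar>\<phi>(t)\<bar> = 1\<close> forces each of them to
  vanish.
\<close>

lemma cf_defect:
  "1 - (norm (cf t))\<^sup>2 = (\<Sum>x\<in>V. \<Sum>y\<in>V. p x * p y * (1 - cos (t * (real_of_int x - real_of_int y))))"
proof -
  have "(norm (cf t))\<^sup>2 = (\<Sum>x\<in>V. \<Sum>y\<in>V. p x * p y * cos (t * (real_of_int x - real_of_int y)))"
    unfolding cmod_power2 Re_cf Im_cf unfolding power2_eq_square sum_product sum.distrib[symmetric]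
    by (intro sum.cong refl) (simp add: cos_diff algebra_simps)
  moreover have "1 = (\<Sum>x\<in>V. \<Sum>y\<in>V. p x * p y)"
    by (simp add: sum_product[symmetric] total)
  ultimately show ?thesis
    by (simp add: sum_subtractf right_diff_distrib)
qed

text \<open>
  If \<open>\<bar>\<phi>(t)\<bar> = 1\<close>, then \<open>t\<close> times any difference of values lies in \<open>2\<pi>\<int>\<close>. The integers \<open>m\<close> with
  \<open>tm \<in> 2\<pi>\<int>\<close> form a nonzero ideal \<open>g\<int>\<close>, so all values are congruent modulo \<open>g\<close> and \<open>g \<le> b\<close>.
  But \<open>tg\<close> is a nonzero multiple of \<open>2\<pi>\<close>, which contradicts \<open>\<bar>t\<bar> < 2\<pi>/b\<close>.
\<close>

lemma norm_cf_less_1: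
  assumes "\<And>g a. \<lbrakk>g > 0; \<forall>x\<in>V. [x = a] (mod g)\<rbrakk> \<Longrightarrow> g \<le> b"
    and "x \<in> V" "y \<in> V" "x \<noteq> y"
    and t: "t \<noteq> 0" "\<bar>t\<bar> < 2 * pi / b" and b: "b > 0"
  shows "norm (cf t) < 1"
proof (rule ccontr)
  assume "\<not> norm (cf t) < 1"
  with norm_cf_le_1[of t] have "norm (cf t) = 1" by simp
  then have zero: "(\<Sum>x\<in>V. \<Sum>y\<in>V. p x * p y * (1 - cos (t * (real_of_int x - real_of_int y)))) = 0"
    using cf_defect[of t] by simp
  have nonneg: "0 \<le> p x * p y * (1 - cos (t * (real_of_int x - real_of_int y)))" if "x \<in> V" "y \<in> V" for x y
    using that pos[of x] pos[of y] by (intro mult_nonneg_nonneg) auto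
  have cos1: "cos (t * (real_of_int x - real_of_int y)) = 1" if "x \<in> V" "y \<in> V" for x y
  proof -
    have "(\<Sum>y\<in>V. p x * p y * (1 - cos (t * (real_of_int x - real_of_int y)))) = 0"
      using zero that fin nonneg by (subst (asm) sum_nonneg_eq_0_iff) (auto intro: sum_nonneg)
    then have "p x * p y * (1 - cos (t * (real_of_int x - real_of_int y))) = 0"
      using that fin nonneg by (subst (asm) sum_nonneg_eq_0_iff) auto
    then show ?thesis using that pos[of x] pos[of y] by auto
  qed
  \<comment> \<open>membership in the ideal of all \<open>m\<close> with \<open>tm \<in> 2\<pi>\<int>\<close>\<close>
  define H where "H m \<longleftrightarrow> cos (t * real_of_int m) = 1" for m
  have H_iff: "H m \<longleftrightarrow> (\<exists>n::int. t * m = n * 2 * pi)" for m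
    by (simp add: H_def cos_one_2pi_int)
  have H_diff: "H (m - n * k)" if "H m" "H k" for m n k
  proof -
    from that obtain i j where "t * m = of_int i * 2 * pi" "t * k = of_int j * 2 * pi"
      by (auto simp: H_iff)
    moreover from this have "t * of_int (m - n * k) = of_int (i - n * j) * 2 * pi"
      by (simp add: algebra_simps)
    ultimately show ?thesis unfolding H_iff by blast
  qed
  have "H (x - y)" "H (y - x)"
    using cos1 assms by (simp_all add: H_def)
  then have "\<exists>m. H (int m) \<and> m > 0"
    using \<open>x \<noteq> y\<close> by (cases x y rule: linorder_cases) (auto intro: exI[of _ "nat (x - y)"] exI[of _ "nat (y - x)"])
  then obtain g where g: "H (int g)" "g > 0" and least: "\<And>m. m < g \<Longrightarrow> \<not> (H (int m) \<and> m > 0)"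
    using exists_least_iff[of "\<lambda>m. H (int m) \<and> m > 0"] by auto
  have dvd: "int g dvd m" if "H m" for m
  proof -
    have "H (m mod int g)"
      using H_diff[OF that g(1), of "m div int g"] by (simp add: minus_div_mult_eq_mod)
    moreover have "0 \<le> m mod int g" "m mod int g < int g" using g by auto
    ultimately have "m mod int g = 0"
      using least[of "nat (m mod int g)"] by (cases "m mod int g = 0") (auto simp: nat_less_iff)
    then show ?thesis by auto
  qed
  have "\<forall>z\<in>V. [z = x] (mod int g)"
    using cos1 \<open>x \<in> V\<close> by (auto simp: cong_iff_dvd_diff H_def intro!: dvd)
  with assms(1) g have "int g \<le> b" by auto
  obtain n where n: "t * real g = of_int n * 2 * pi" using g(1) by (auto simp: H_iff)
  have "n \<noteq> 0" using n t g by auto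
  then have "1 \<le> \<bar>real_of_int n\<bar>" by linarith
  then have "2 * pi \<le> \<bar>real_of_int n\<bar> * (2 * pi)" by simp
  also have "\<dots> = \<bar>t\<bar> * real g" using arg_cong[OF n, of abs] by (simp add: abs_mult)
  also have "\<dots> \<le> \<bar>t\<bar> * b" using \<open>int g \<le> b\<close> by (intro mult_left_mono) linarith+
  also have "\<dots> < 2 * pi" using t b by (simp add: field_simps)
  finally show False by simp
qed

end

text \<open>
  The number \<open>b\<close> stands for the span, through its maximality: that is the property which keeps
  \<open>\<bar>\<phi>(t)\<bar>\<close> below \<open>1\<close> for \<open>0 < \<bar>t\<bar> \<le> \<pi>/b\<close>.
\<close>

locale centred_law = finite_law +
  fixes b :: int and \<sigma> \<mu>3 :: real
  assumes mean: "(\<Sum>x\<in>V. p x * of_int x) = 0"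
    and variance: "\<sigma>\<^sup>2 = (\<Sum>x\<in>V. p x * (of_int x)\<^sup>2)" and sd_pos: "\<sigma> > 0"
    and third_moment: "\<mu>3 = (\<Sum>x\<in>V. p x * of_int x ^ 3)"
    and span_pos: "b > 0"
    and span_greatest: "\<lbrakk>g > 0; \<forall>x\<in>V. [x = a] (mod g)\<rbrakk> \<Longrightarrow> g \<le> b"
begin

text \<open>
  A single value would be congruent to itself modulo \<open>b + 1\<close>, so the existence of a largest modulus
  already excludes a degenerate law.
\<close>

lemma two_values: "\<exists>x\<in>V. \<exists>y\<in>V. x \<noteq> y"
proof (rule ccontr)
  assume "\<not> ?thesis"
  then obtain a where "\<forall>x\<in>V. x = a" by blast
  then have "\<forall>x\<in>V. [x = a] (mod (b + 1))" by auto
  from span_greatest[OF _ this] span_pos show False by auto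
qed

text \<open>
  The limit appears as half the second moment of the symmetrised law, which is the variance.
\<close>

lemma defect_limit: "((\<lambda>t. (1 - (norm (cf t))\<^sup>2) / t\<^sup>2) \<longlongrightarrow> \<sigma>\<^sup>2) (at 0)"
proof -
  have "((\<lambda>t. \<Sum>x\<in>V. \<Sum>y\<in>V. p x * p y * ((1 - cos (t * (real_of_int x - real_of_int y))) / t\<^sup>2))
     \<longlongrightarrow> (\<Sum>x\<in>V. \<Sum>y\<in>V. p x * p y * ((real_of_int x - real_of_int y)\<^sup>2 / 2))) (at 0)"
    by (intro tendsto_sum tendsto_mult tendsto_const cos_defect_limit)
  moreover have "(\<Sum>x\<in>V. \<Sum>y\<in>V. p x * p y * ((real_of_int x - real_of_int y)\<^sup>2 / 2)) = \<sigma>\<^sup>2"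
  proof -
    have "(\<Sum>x\<in>V. \<Sum>y\<in>V. p x * p y * ((real_of_int x - real_of_int y)\<^sup>2 / 2))
      = (\<Sum>x\<in>V. \<Sum>y\<in>V. (p x * (of_int x)\<^sup>2 / 2) * p y + p x * (p y * (of_int y)\<^sup>2 / 2)
            - (p x * of_int x) * (p y * of_int y))"
      by (intro sum.cong refl) (simp add: power2_eq_square field_simps)
    also have "\<dots> = \<sigma>\<^sup>2"
      by (simp add: sum.distrib sum_subtractf sum_product[symmetric] total mean
          sum_divide_distrib[symmetric] variance[symmetric])
    finally show ?thesis .
  qed
  ultimately show ?thesis
    by (simp add: cf_defect sum_divide_distrib)
qed

text \<open>
  The linear terms of the sines add up to \<open>t\<close> times the mean, hence cancel; the third moment is what
  remains.
\<close>

lemma Im_cf_limit: "((\<lambda>t. Im (cf t) / t ^ 3) \<longlongrightarrow> - \<mu>3 / 6) (at 0)"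
proof -
  have "((\<lambda>t. \<Sum>x\<in>V. p x * ((sin (t * of_int x) - t * of_int x) / t ^ 3)) \<longlongrightarrow> (\<Sum>x\<in>V. p x * (- (of_int x ^ 3) / 6))) (at 0)"
    by (intro tendsto_sum tendsto_mult tendsto_const sin_cubic_limit)
  moreover have "(\<Sum>x\<in>V. p x * ((sin (t * of_int x) - t * of_int x) / t ^ 3)) = Im (cf t) / t ^ 3" for t
  proof -
    have "(\<Sum>x\<in>V. p x * ((sin (t * of_int x) - t * of_int x) / t ^ 3))
       = (Im (cf t) - t * (\<Sum>x\<in>V. p x * of_int x)) / t ^ 3"
      by (simp add: Im_cf sum_distrib_left sum_subtractf right_diff_distrib diff_divide_distrib
          sum_divide_distrib mult_ac)
    then show ?thesis by (simp add: mean)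
  qed
  moreover have "(\<Sum>x\<in>V. p x * (- (of_int x ^ 3) / 6)) = - \<mu>3 / 6"
    by (simp add: third_moment sum_negf sum_divide_distrib)
  ultimately show ?thesis by simp
qed

lemma Im_cf_cubic_bound: "\<exists>C\<ge>0. \<forall>t. \<bar>Im (cf t)\<bar> \<le> C * \<bar>t\<bar> ^ 3"
proof (intro exI conjI allI)
  show "0 \<le> (\<Sum>x\<in>V. p x * (\<bar>real_of_int x\<bar> ^ 3 / 6))"
    by (intro sum_nonneg) (auto dest: pos less_imp_le)
  fix t
  have "Im (cf t) = (\<Sum>x\<in>V. p x * (sin (t * of_int x) - t * of_int x)) + t * (\<Sum>x\<in>V. p x * of_int x)"
    by (simp add: Im_cf sum_distrib_left sum.distrib[symmetric] algebra_simps)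
  then have "\<bar>Im (cf t)\<bar> \<le> (\<Sum>x\<in>V. \<bar>p x * (sin (t * of_int x) - t * of_int x)\<bar>)"
    by (simp add: mean sum_abs)
  also have "\<dots> \<le> (\<Sum>x\<in>V. p x * (\<bar>t * of_int x\<bar> ^ 3 / 6))"
  proof (intro sum_mono)
    fix x assume "x \<in> V"
    then have "0 \<le> p x" by (auto dest: pos)
    then show "\<bar>p x * (sin (t * of_int x) - t * of_int x)\<bar> \<le> p x * (\<bar>t * of_int x\<bar> ^ 3 / 6)"
      unfolding abs_mult[of "p x"] using sin_sub_self_bound[of "t * of_int x"]
      by (simp only: abs_of_nonneg) (rule mult_left_mono)
  qed
  also have "\<dots> = (\<Sum>x\<in>V. p x * (\<bar>real_of_int x\<bar> ^ 3 / 6)) * \<bar>t\<bar> ^ 3"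
    unfolding sum_distrib_right by (intro sum.cong refl) (simp add: abs_mult power_mult_distrib)
  finally show "\<bar>Im (cf t)\<bar> \<le> (\<Sum>x\<in>V. p x * (\<bar>real_of_int x\<bar> ^ 3 / 6)) * \<bar>t\<bar> ^ 3" .
qed

text \<open>
  The quotient \<open>(1 - \<bar>\<phi>(t)\<bar>\<^sup>2)/t\<^sup>2\<close>, extended by \<open>\<sigma>\<^sup>2\<close> at the origin, is continuous and positive on the
  compact period, so it has a positive minimum.
\<close>

lemma norm_cf_gaussian_bound: "\<exists>\<kappa>>0. \<forall>t. \<bar>t\<bar> \<le> pi / b \<longrightarrow> norm (cf t) \<le> exp (- \<kappa> * t\<^sup>2)"
proof -
  define g where "g t = (if t = 0 then \<sigma>\<^sup>2 else (1 - (norm (cf t))\<^sup>2) / t\<^sup>2)" for t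
  have pb: "0 < pi / b" using span_pos by simp
  have "isCont g t" for t
  proof (cases "t = 0")
    case True
    have "(g \<longlongrightarrow> \<sigma>\<^sup>2) (at 0)"
      by (rule Lim_transform_eventually[OF defect_limit]) (auto simp: g_def eventually_at_filter)
    then show ?thesis by (simp add: isCont_def True g_def)
  next
    case False
    have "isCont (\<lambda>t. (1 - (norm (cf t))\<^sup>2) / t\<^sup>2) t"
      using False isCont_cf by (intro continuous_intros) auto
    moreover have "\<forall>\<^sub>F s in nhds t. g s = (1 - (norm (cf s))\<^sup>2) / s\<^sup>2"
      using t1_space_nhds[OF False] by eventually_elim (simp add: g_def)
    ultimately show ?thesis by (simp add: isCont_cong)
  qed
  then have "continuous_on {- (pi / b)..pi / b} g" by (simp add: continuous_at_imp_continuous_on)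
  then obtain s where s: "s \<in> {- (pi / b)..pi / b}" "\<And>t. t \<in> {- (pi / b)..pi / b} \<Longrightarrow> g s \<le> g t"
    using continuous_attains_inf[of "{- (pi / b)..pi / b}" g] pb by auto
  have "g s > 0"
  proof (cases "s = 0")
    case False
    obtain x y where xy: "x \<in> V" "y \<in> V" "x \<noteq> y" using two_values by blast
    have "\<bar>s\<bar> \<le> pi / b" using s(1) by auto
    also have "\<dots> < 2 * pi / b" using span_pos by (simp add: divide_strict_right_mono)
    finally have "norm (cf s) < 1"
      using norm_cf_less_1[OF span_greatest xy False _ span_pos] by auto
    then have "(norm (cf s))\<^sup>2 < 1" by (simp add: power_less_one_iff abs_square_less_1)
    then show ?thesis using False by (simp add: g_def)
  qed (use sd_pos in \<open>simp add: g_def\<close>)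
  show ?thesis
  proof (intro exI[of _ "g s / 2"] conjI allI impI)
    fix t assume t: "\<bar>t\<bar> \<le> pi / b"
    show "norm (cf t) \<le> exp (- (g s / 2) * t\<^sup>2)"
    proof (cases "t = 0")
      case False
      have "g s \<le> (1 - (norm (cf t))\<^sup>2) / t\<^sup>2" using s(2)[of t] t False by (auto simp: g_def abs_le_iff)
      then have "(norm (cf t))\<^sup>2 \<le> 1 + (- (g s * t\<^sup>2))" using False by (simp add: field_simps)
      also have "\<dots> \<le> exp (- (g s * t\<^sup>2))" by (rule exp_ge_add_one_self)
      also have "\<dots> = (exp (- (g s / 2) * t\<^sup>2))\<^sup>2" by (simp add: exp_double[symmetric])
      finally show ?thesis by (rule power2_le_imp_le) simp
    qed (simp add: cf_0)
  qed (use \<open>g s > 0\<close> in simp)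
qed

end

section \<open>Gaussian integrals\<close>

lemma integrable_quadratic_gaussian:
  fixes A B c :: real
  assumes c: "c > 0"
  shows "integrable lborel (\<lambda>w. (A * w\<^sup>2 + B) * exp (- c * w\<^sup>2))"
proof -
  define s where "s = 1 / sqrt (2 * c)"
  have "integrable lborel (\<lambda>w. sqrt (2 * pi * s\<^sup>2) * (A * (normal_density 0 s w * (w - 0) ^ 2)
      + B * (normal_density 0 s w * (w - 0) ^ 0)))"
    by (intro integrable_mult_right Bochner_Integration.integrable_add integrable_normal_moment) (use c in \<open>simp_all add: s_def\<close>)
  also have "(\<lambda>w. sqrt (2 * pi * s\<^sup>2) * (A * (normal_density 0 s w * (w - 0) ^ 2)
      + B * (normal_density 0 s w * (w - 0) ^ 0))) = (\<lambda>w. (A * w\<^sup>2 + B) * exp (- c * w\<^sup>2))"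
  proof
    fix w
    have "s\<^sup>2 > 0" "s\<^sup>2 = 1 / (2 * c)" using c by (simp_all add: s_def power_divide)
    then have "sqrt (2 * pi * s\<^sup>2) * normal_density 0 s w = exp (- c * w\<^sup>2)"
      by (simp add: normal_density_def)
    then show "sqrt (2 * pi * s\<^sup>2) * (A * (normal_density 0 s w * (w - 0) ^ 2)
      + B * (normal_density 0 s w * (w - 0) ^ 0)) = (A * w\<^sup>2 + B) * exp (- c * w\<^sup>2)"
      by (simp add: algebra_simps)
  qed
  finally show ?thesis .
qed

lemma integral_quadratic_std_gaussian:
  fixes A B :: real
  shows "(\<integral>w. (A * w\<^sup>2 + B) * exp (- w\<^sup>2 / 2) \<partial>lborel) = sqrt (2 * pi) * (A + B)"
proof -
  have "has_bochner_integral lborel (\<lambda>w. sqrt (2 * pi) * (A * (std_normal_density w * w ^ (2 * 1))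
      + B * (std_normal_density w * w ^ (2 * 0))))
     (sqrt (2 * pi) * (A * (fact (2 * 1) / (2 ^ 1 * fact 1)) + B * (fact (2 * 0) / (2 ^ 0 * fact 0))))"
    by (intro has_bochner_integral_mult_right has_bochner_integral_add std_normal_moment_even)
  moreover have "sqrt (2 * pi) * (A * (std_normal_density w * w ^ (2 * 1))
      + B * (std_normal_density w * w ^ (2 * 0))) = (A * w\<^sup>2 + B) * exp (- w\<^sup>2 / 2)" for w
  proof -
    have e: "exp (- w\<^sup>2 / 2) = sqrt (2 * pi) * std_normal_density w"
      by (simp add: std_normal_density_def)
    show ?thesis unfolding e by (simp add: algebra_simps power2_eq_square)
  qed
  ultimately have "has_bochner_integral lborel (\<lambda>w. (A * w\<^sup>2 + B) * exp (- w\<^sup>2 / 2))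
     (sqrt (2 * pi) * (A * (fact (2 * 1) / (2 ^ 1 * fact 1)) + B * (fact (2 * 0) / (2 ^ 0 * fact 0))))"
    by (simp only:)
  then show ?thesis by (simp add: has_bochner_integral_iff)
qed

section \<open>Asymptotics of the inversion integral\<close>

context centred_law
begin

definition inversion_integrand :: "real \<Rightarrow> nat \<Rightarrow> real \<Rightarrow> real" where
  "inversion_integrand d n t = Im (cf t ^ n * cis (t * d)) / sin (real_of_int b * t / 2) * indicator {- (pi / b)..pi / b} t"

lemma borel_measurable_inversion_integrand [measurable]:
  "inversion_integrand d n \<in> borel_measurable borel"
proof -
  have [measurable]: "(\<lambda>t. Im (cf t ^ n * cis (t * d))) \<in> borel_measurable borel"
    by (intro borel_measurable_continuous_onI continuous_intros)
  show ?thesis unfolding inversion_integrand_def by measurable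
qed

text \<open>
  The bound depends on \<open>n\<close> and \<open>t\<close> only through \<open>nt\<^sup>2\<close>, which is \<open>w\<^sup>2/\<sigma>\<^sup>2\<close> after the substitution
  \<open>t = w/(\<sigma>\<surd>n)\<close>; that makes it an integrable majorant independent of \<open>n\<close>. The numerator is at most
  \<open>\<bar>t\<bar>\<close> times such an expression because \<open>Im (\<phi>^n)\<close> is bounded by \<open>n\<bar>t\<bar>\<^sup>3\<close> and \<open>sin (td)\<close> by
  \<open>\<bar>td\<bar>\<close>, and the sine in the denominator absorbs the factor \<open>\<bar>t\<bar>\<close>.
\<close>

lemma inversion_integrand_bound:
  "\<exists>A B c. c > 0 \<and> (\<forall>n t. \<bar>inversion_integrand d n t\<bar>
      \<le> (A * (real n * t\<^sup>2) + B) * exp (- c * (real n * t\<^sup>2)))"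
proof -
  from Im_cf_cubic_bound obtain C where C: "C \<ge> 0" "\<And>t. \<bar>Im (cf t)\<bar> \<le> C * \<bar>t\<bar> ^ 3" by blast
  from norm_cf_gaussian_bound obtain c where c: "c > 0"
    "\<And>t. \<bar>t\<bar> \<le> pi / b \<Longrightarrow> norm (cf t) \<le> exp (- c * t\<^sup>2)" by blast
  \<comment> \<open>\<open>K\<close> pays for the one Gaussian factor lost in \<open>\<bar>\<phi>\<bar>^(n-1)\<close>\<close>
  define K where "K = exp (c * (pi / b)\<^sup>2)"
  have K: "1 \<le> K" using c by (simp add: K_def)
  have bpos: "real_of_int b > 0" using span_pos by simp
  have "\<bar>inversion_integrand d n t\<bar>
      \<le> (6 * K * C / b * (real n * t\<^sup>2) + 6 * K * \<bar>d\<bar> / b) * exp (- c * (real n * t\<^sup>2))" for n t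
  proof (cases "t \<noteq> 0 \<and> t \<in> {- (pi / b)..pi / b}")
    case True
    then have t: "t \<noteq> 0" "\<bar>t\<bar> \<le> pi / b" by auto
    define N where "N = K * exp (- c * (real n * t\<^sup>2))"
    have pw: "norm (cf t) ^ m \<le> exp (- c * (real m * t\<^sup>2))" for m
      using power_mono[OF c(2)[OF t(2)], of m] by (simp add: exp_of_nat_mult[symmetric] algebra_simps)
    have N1: "norm (cf t) ^ n \<le> N"
      using pw[of n] K by (simp add: N_def mult_left_le order_trans[OF _ mult_right_mono[of 1 K, simplified]])
    have N2: "norm (cf t) ^ (n - 1) \<le> N"
    proof (cases n)
      case 0
      then show ?thesis using K by (simp add: N_def)
    next
      case (Suc m)
      have "t\<^sup>2 \<le> (pi / b)\<^sup>2" using t(2) by (metis abs_le_square_iff abs_of_nonneg abs_ge_zero order_trans)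
      then have "c * t\<^sup>2 \<le> c * (pi / b)\<^sup>2" using c by simp
      then have "- c * (real m * t\<^sup>2) \<le> c * (pi / b)\<^sup>2 + - c * (real n * t\<^sup>2)"
        by (simp add: Suc algebra_simps)
      then have "exp (- c * (real m * t\<^sup>2)) \<le> N"
        by (simp only: N_def K_def mult_exp_exp exp_le_cancel_iff)
      then show ?thesis using pw[of m] Suc by simp
    qed
    have N0: "0 \<le> N" using K by (simp add: N_def)
    have "\<bar>Im (cf t ^ n * cis (t * d))\<bar> \<le> \<bar>Im (cf t ^ n)\<bar> * \<bar>cos (t * d)\<bar> + \<bar>Re (cf t ^ n)\<bar> * \<bar>sin (t * d)\<bar>"
      by (simp add: abs_mult[symmetric])
    also have "\<dots> \<le> \<bar>Im (cf t ^ n)\<bar> * 1 + norm (cf t ^ n) * \<bar>t * d\<bar>"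
      by (intro add_mono mult_mono abs_Re_le_cmod abs_sin_x_le_abs_x) auto
    also have "\<dots> \<le> real n * (C * \<bar>t\<bar> ^ 3) * N + N * \<bar>t * d\<bar>"
    proof (intro add_mono mult_right_mono)
      have "\<bar>Im (cf t ^ n)\<bar> * 1 \<le> real n * \<bar>Im (cf t)\<bar> * norm (cf t) ^ (n - 1)"
        using abs_Im_power_le[of "cf t" n] by simp
      also have "\<dots> \<le> real n * (C * \<bar>t\<bar> ^ 3) * N"
        using C N2 by (intro mult_mono mult_left_mono) auto
      finally show "\<bar>Im (cf t ^ n)\<bar> * 1 \<le> real n * (C * \<bar>t\<bar> ^ 3) * N" .
    qed (use N1 in \<open>auto simp: norm_power\<close>)
    also have "\<dots> = \<bar>t\<bar> * ((C * (real n * t\<^sup>2) + \<bar>d\<bar>) * N)"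
      by (simp add: abs_mult power3_eq_cube power2_eq_square algebra_simps)
    finally have num: "\<bar>Im (cf t ^ n * cis (t * d))\<bar> \<le> \<bar>t\<bar> * ((C * (real n * t\<^sup>2) + \<bar>d\<bar>) * N)" .
    have "\<bar>b * t / 2\<bar> \<le> pi / 2" using t bpos by (simp add: abs_mult field_simps)
    then have den: "b * \<bar>t\<bar> / 6 \<le> \<bar>sin (b * t / 2)\<bar>" using abs_sin_ge_third[of "b * t / 2"] bpos
      by (simp add: abs_mult)
    have "\<bar>inversion_integrand d n t\<bar> = \<bar>Im (cf t ^ n * cis (t * d))\<bar> / \<bar>sin (b * t / 2)\<bar>"
      using True by (simp add: inversion_integrand_def abs_mult)
    also have "\<dots> \<le> (\<bar>t\<bar> * ((C * (real n * t\<^sup>2) + \<bar>d\<bar>) * N)) / (b * \<bar>t\<bar> / 6)"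
      using t bpos C N0 by (intro frac_le num den) auto
    also have "\<dots> = (6 * K * C / b * (real n * t\<^sup>2) + 6 * K * \<bar>d\<bar> / b) * exp (- c * (real n * t\<^sup>2))"
      using t bpos by (simp add: N_def field_simps)
    finally show ?thesis .
  next
    case False
    then have "inversion_integrand d n t = 0" by (auto simp: inversion_integrand_def)
    then show ?thesis using C K bpos by simp
  qed
  with c(1) show ?thesis by blast
qed

text \<open>
  In polar form \<open>\<phi>(\<tau>) = \<bar>\<phi>(\<tau>)\<bar> e^(i\<theta>)\<close> the integrand is \<open>\<bar>\<phi>(\<tau>)\<bar>^n sin(n\<theta> + \<tau>d) / sin(b\<tau>/2)\<close> with
  \<open>\<tau> = w/(\<sigma>\<surd>n)\<close>. The first factor tends to \<open>e^(-w\<^sup>2/2)\<close>. Both sines have arguments tending to zero, so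
  their quotient behaves like \<open>(2/b)(n\<theta>/\<tau> + d)\<close>, and \<open>n\<theta>/\<tau> = n\<tau>\<^sup>2 \<cdot> \<theta>/\<tau>\<^sup>3\<close> tends to
  \<open>(w\<^sup>2/\<sigma>\<^sup>2)(-\<mu>\<^sub>3/6)\<close>.
\<close>

lemma inversion_integrand_limit:
  assumes w: "w \<noteq> 0"
  shows "(\<lambda>n. inversion_integrand d n (w / (\<sigma> * sqrt (real n))))
    \<longlonglongrightarrow> 2 / b * ((- \<mu>3 / (6 * \<sigma>\<^sup>2)) * w\<^sup>2 + d) * exp (- w\<^sup>2 / 2)"
proof -
  define \<tau> where "\<tau> n = w / (\<sigma> * sqrt (real n))" for n
  have bpos: "real_of_int b > 0" using span_pos by simp
  have nz: "\<forall>\<^sub>F n in sequentially. \<tau> n \<noteq> 0"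
    using eventually_gt_at_top[of 0] by eventually_elim (use w sd_pos in \<open>simp add: \<tau>_def\<close>)
  have \<tau>0: "\<tau> \<longlonglongrightarrow> 0"
  proof -
    have "(\<lambda>n. w / \<sigma> * (1 / sqrt (real n))) \<longlonglongrightarrow> w / \<sigma> * 0"
      by (intro tendsto_mult tendsto_const) real_asymp
    then show ?thesis by (simp add: \<tau>_def[abs_def])
  qed
  then have at0: "filterlim \<tau> (at 0) sequentially" using nz by (simp add: filterlim_at)
  have n\<tau>2: "\<forall>\<^sub>F n in sequentially. real n * (\<tau> n)\<^sup>2 = w\<^sup>2 / \<sigma>\<^sup>2"
    using eventually_gt_at_top[of 0] by eventually_elim (simp add: \<tau>_def power_divide power_mult_distrib)

  have modulus: "(\<lambda>n. norm (cf (\<tau> n)) ^ n) \<longlonglongrightarrow> exp (- w\<^sup>2 / 2)"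
  proof -
    have "(\<lambda>n. - (w\<^sup>2 / \<sigma>\<^sup>2) * ((1 - (norm (cf (\<tau> n)))\<^sup>2) / (\<tau> n)\<^sup>2)) \<longlonglongrightarrow> - (w\<^sup>2 / \<sigma>\<^sup>2) * \<sigma>\<^sup>2"
      by (intro tendsto_mult tendsto_const filterlim_compose[OF defect_limit at0])
    moreover have "\<forall>\<^sub>F n in sequentially. - (w\<^sup>2 / \<sigma>\<^sup>2) * ((1 - (norm (cf (\<tau> n)))\<^sup>2) / (\<tau> n)\<^sup>2)
        = real n * ((norm (cf (\<tau> n)))\<^sup>2 - 1)"
      using n\<tau>2 nz
    proof eventually_elim
      case (elim n)
      show ?case unfolding elim(1)[symmetric] using elim(2) by (simp add: field_simps)
    qed
    ultimately have "(\<lambda>n. real n * ((norm (cf (\<tau> n)))\<^sup>2 - 1)) \<longlonglongrightarrow> - w\<^sup>2"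
      using sd_pos by (simp add: filterlim_cong)
    then have "(\<lambda>n. (1 + ((norm (cf (\<tau> n)))\<^sup>2 - 1)) ^ n) \<longlonglongrightarrow> exp (- w\<^sup>2)"
      by (rule one_plus_over_n_power_limit)
    then have "(\<lambda>n. sqrt ((1 + ((norm (cf (\<tau> n)))\<^sup>2 - 1)) ^ n)) \<longlonglongrightarrow> sqrt (exp (- w\<^sup>2))"
      by (rule tendsto_real_sqrt)
    moreover have "sqrt ((1 + ((norm (cf (\<tau> n)))\<^sup>2 - 1)) ^ n) = norm (cf (\<tau> n)) ^ n" for n
      by (simp add: real_sqrt_power)
    moreover have "sqrt (exp (- w\<^sup>2)) = exp (- w\<^sup>2 / 2)"
      by (rule real_sqrt_unique) (auto simp: exp_double[symmetric])
    ultimately show ?thesis by simp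
  qed

  \<comment> \<open>the principal argument, since the real part is eventually positive\<close>
  define \<theta> where "\<theta> n = arctan (Im (cf (\<tau> n)) / Re (cf (\<tau> n)))" for n
  have cf1: "(\<lambda>n. cf (\<tau> n)) \<longlonglongrightarrow> 1"
    using isCont_tendsto_compose[OF isCont_cf \<tau>0] by (simp add: cf_0)
  have Re1: "(\<lambda>n. Re (cf (\<tau> n))) \<longlonglongrightarrow> 1" and Im0: "(\<lambda>n. Im (cf (\<tau> n))) \<longlonglongrightarrow> 0"
    using tendsto_Re[OF cf1] tendsto_Im[OF cf1] by simp_all
  have "\<forall>\<^sub>F n in sequentially. Re (cf (\<tau> n)) > 0" using Re1 by (rule order_tendstoD) simp
  then have polar: "\<forall>\<^sub>F n in sequentially. Im (cf (\<tau> n) ^ n * cis (\<tau> n * d))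
      = norm (cf (\<tau> n)) ^ n * sin (real n * \<theta> n + \<tau> n * d)"
  proof eventually_elim
    case (elim n)
    have "cf (\<tau> n) = rcis (norm (cf (\<tau> n))) (\<theta> n)"
    proof -
      have e: "norm (cf (\<tau> n)) = Re (cf (\<tau> n)) * sqrt (1 + (Im (cf (\<tau> n)) / Re (cf (\<tau> n)))\<^sup>2)"
      proof -
        have "(Re (cf (\<tau> n)) * sqrt (1 + (Im (cf (\<tau> n)) / Re (cf (\<tau> n)))\<^sup>2))\<^sup>2 = (norm (cf (\<tau> n)))\<^sup>2"
          using elim by (simp add: power_mult_distrib cmod_power2 power_divide field_simps)
        then show ?thesis using elim by (metis abs_norm_cancel less_imp_le mult_nonneg_nonneg
          power2_eq_iff_nonneg real_sqrt_ge_zero norm_ge_zero zero_le_power2 add_nonneg_nonneg zero_le_one)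
      qed
      have "sqrt (1 + (Im (cf (\<tau> n)) / Re (cf (\<tau> n)))\<^sup>2) > 0"
        by (simp add: add_pos_nonneg)
      then show ?thesis
        using elim by (simp add: complex_eq_iff \<theta>_def cos_arctan sin_arctan e)
    qed
    then have "cf (\<tau> n) ^ n = rcis (norm (cf (\<tau> n)) ^ n) (real n * \<theta> n)"
      by (metis DeMoivre2)
    then show ?case by (simp add: rcis_def cis_mult mult.assoc sin_add distrib_left)
  qed

  have "(\<lambda>n. Im (cf (\<tau> n)) / Re (cf (\<tau> n))) \<longlonglongrightarrow> 0 / 1"
    by (intro tendsto_divide Re1 Im0) simp
  then have ratio0: "(\<lambda>n. Im (cf (\<tau> n)) / Re (cf (\<tau> n))) \<longlonglongrightarrow> 0" by simp
  have "((\<lambda>x::real. arctan x / x) \<longlongrightarrow> 1) (at 0)" by real_asymp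
  then obtain r where r: "\<And>n. \<theta> n = Im (cf (\<tau> n)) / Re (cf (\<tau> n)) * r n" "r \<longlonglongrightarrow> 1"
    unfolding \<theta>_def by (rule factor_through_ratio[OF _ _ ratio0]) auto
  have "(\<lambda>n. (w\<^sup>2 / \<sigma>\<^sup>2) * (Im (cf (\<tau> n)) / \<tau> n ^ 3 / Re (cf (\<tau> n)) * r n) + d)
     \<longlonglongrightarrow> (w\<^sup>2 / \<sigma>\<^sup>2) * ((- \<mu>3 / 6) / 1 * 1) + d"
    by (intro tendsto_add tendsto_mult tendsto_divide tendsto_const filterlim_compose[OF Im_cf_limit at0] Re1 r) simp
  moreover have "\<forall>\<^sub>F n in sequentially. (w\<^sup>2 / \<sigma>\<^sup>2) * (Im (cf (\<tau> n)) / \<tau> n ^ 3 / Re (cf (\<tau> n)) * r n) + d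
     = (real n * \<theta> n + \<tau> n * d) / \<tau> n"
    using n\<tau>2 nz
  proof eventually_elim
    case (elim n)
    show ?case unfolding elim(1)[symmetric] r(1) using elim(2)
      by (simp add: add_divide_distrib power2_eq_square power3_eq_cube)
  qed
  ultimately have angle: "(\<lambda>n. (real n * \<theta> n + \<tau> n * d) / \<tau> n) \<longlonglongrightarrow> (- \<mu>3 / (6 * \<sigma>\<^sup>2)) * w\<^sup>2 + d"
    by (simp add: filterlim_cong mult_ac)
  have "(\<lambda>n. \<tau> n * ((real n * \<theta> n + \<tau> n * d) / \<tau> n)) \<longlonglongrightarrow> 0 * ((- \<mu>3 / (6 * \<sigma>\<^sup>2)) * w\<^sup>2 + d)"
    by (intro tendsto_mult \<tau>0 angle)
  moreover have "\<forall>\<^sub>F n in sequentially. \<tau> n * ((real n * \<theta> n + \<tau> n * d) / \<tau> n) = real n * \<theta> n + \<tau> n * d"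
    using nz by eventually_elim simp
  ultimately have angle0: "(\<lambda>n. real n * \<theta> n + \<tau> n * d) \<longlonglongrightarrow> 0"
    by (simp add: filterlim_cong)
  have sinc: "((\<lambda>x::real. sin x / x) \<longlongrightarrow> 1) (at 0)" by real_asymp
  obtain s1 where s1: "\<And>n. sin (real n * \<theta> n + \<tau> n * d) = (real n * \<theta> n + \<tau> n * d) * s1 n" "s1 \<longlonglongrightarrow> 1"
    by (rule factor_through_ratio[OF sinc _ angle0]) auto
  have "(\<lambda>n. b / 2 * \<tau> n) \<longlonglongrightarrow> b / 2 * 0" by (intro tendsto_mult tendsto_const \<tau>0)
  then have "(\<lambda>n. b * \<tau> n / 2) \<longlonglongrightarrow> 0" by simp
  then obtain s2 where s2: "\<And>n. sin (b * \<tau> n / 2) = b * \<tau> n / 2 * s2 n" "s2 \<longlonglongrightarrow> 1"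
    by (rule factor_through_ratio[OF sinc, rotated]) auto
  have "(\<lambda>n. norm (cf (\<tau> n)) ^ n * ((real n * \<theta> n + \<tau> n * d) / \<tau> n * s1 n) / (b / 2 * s2 n))
    \<longlonglongrightarrow> exp (- w\<^sup>2 / 2) * (((- \<mu>3 / (6 * \<sigma>\<^sup>2)) * w\<^sup>2 + d) * 1) / (b / 2 * 1)"
    by (intro tendsto_mult tendsto_divide tendsto_const modulus angle s1 s2) (use bpos in auto)
  moreover have "\<forall>\<^sub>F n in sequentially. \<bar>\<tau> n\<bar> < pi / b"
    using tendstoD[OF \<tau>0, of "pi / b"] bpos by (simp add: dist_real_def)
  then have "\<forall>\<^sub>F n in sequentially.
      norm (cf (\<tau> n)) ^ n * ((real n * \<theta> n + \<tau> n * d) / \<tau> n * s1 n) / (b / 2 * s2 n)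
      = inversion_integrand d n (\<tau> n)"
    using nz polar
  proof eventually_elim
    case (elim n)
    then have "\<tau> n \<in> {- (pi / b)..pi / b}" by auto
    then show ?case
      using elim(2,3) by (simp add: inversion_integrand_def s1(1) s2(1))
  qed
  ultimately have "(\<lambda>n. inversion_integrand d n (\<tau> n))
      \<longlonglongrightarrow> exp (- w\<^sup>2 / 2) * (((- \<mu>3 / (6 * \<sigma>\<^sup>2)) * w\<^sup>2 + d) * 1) / (b / 2 * 1)"
    by (simp add: filterlim_cong)
  moreover have "exp (- w\<^sup>2 / 2) * (q * 1) / (b / 2 * 1) = 2 / b * q * exp (- w\<^sup>2 / 2)" for q
    by simp
  ultimately show ?thesis unfolding \<tau>_def by (simp only:)
qed

lemma inversion_integral_limit:
  "(\<lambda>n. sqrt (real n) * (b / (2 * pi) * (\<integral>t. inversion_integrand d n t \<partial>lborel)))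
    \<longlonglongrightarrow> (2 * d / \<sigma> - \<mu>3 / (3 * \<sigma> ^ 3)) / sqrt (2 * pi)"
proof -
  have bpos: "real_of_int b > 0" using span_pos by simp
  from inversion_integrand_bound obtain A B c where c: "c > 0"
    and bound: "\<And>n t. \<bar>inversion_integrand d n t\<bar> \<le> (A * (real n * t\<^sup>2) + B) * exp (- c * (real n * t\<^sup>2))" by blast
  let ?F = "\<lambda>n w. inversion_integrand d (Suc n) (w / (\<sigma> * sqrt (real (Suc n))))"
  let ?G = "\<lambda>w. 2 / b * ((- \<mu>3 / (6 * \<sigma>\<^sup>2)) * w\<^sup>2 + d) * exp (- w\<^sup>2 / 2)"
  have "(\<lambda>n. \<integral>w. ?F n w \<partial>lborel) \<longlonglongrightarrow> (\<integral>w. ?G w \<partial>lborel)"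
  proof (rule integral_dominated_convergence)
    show "integrable lborel (\<lambda>w. (A / \<sigma>\<^sup>2 * w\<^sup>2 + B) * exp (- (c / \<sigma>\<^sup>2) * w\<^sup>2))"
      using c sd_pos by (intro integrable_quadratic_gaussian) simp
    show "AE w in lborel. (\<lambda>n. ?F n w) \<longlonglongrightarrow> ?G w"
      using AE_lborel_singleton[of 0]
    proof eventually_elim
      case (elim w)
      then show ?case by (rule LIMSEQ_Suc[OF inversion_integrand_limit])
    qed
    show "AE w in lborel. norm (?F n w) \<le> (A / \<sigma>\<^sup>2 * w\<^sup>2 + B) * exp (- (c / \<sigma>\<^sup>2) * w\<^sup>2)" for n
    proof (rule AE_I2)
      fix w
      have "real (Suc n) * (w / (\<sigma> * sqrt (real (Suc n))))\<^sup>2 = w\<^sup>2 / \<sigma>\<^sup>2"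
        by (simp add: power_divide power_mult_distrib del: of_nat_Suc)
      then show "norm (?F n w) \<le> (A / \<sigma>\<^sup>2 * w\<^sup>2 + B) * exp (- (c / \<sigma>\<^sup>2) * w\<^sup>2)"
        using bound[of "Suc n" "w / (\<sigma> * sqrt (real (Suc n)))"] by simp
    qed
  qed measurable
  moreover have "(\<integral>w. ?F n w \<partial>lborel) = \<sigma> * sqrt (real (Suc n)) * (\<integral>t. inversion_integrand d (Suc n) t \<partial>lborel)" for n
  proof -
    define s where "s = \<sigma> * sqrt (real (Suc n))"
    have "s > 0" using sd_pos by (simp add: s_def)
    then have "(\<integral>t. inversion_integrand d (Suc n) t \<partial>lborel) = 1 / s * (\<integral>w. inversion_integrand d (Suc n) (w / s) \<partial>lborel)"
      using lborel_integral_real_affine[of "1 / s" "inversion_integrand d (Suc n)" 0] by simp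
    then show ?thesis unfolding s_def[symmetric] using \<open>s > 0\<close> by simp
  qed
  moreover have "(\<integral>w. ?G w \<partial>lborel) = 2 / b * (sqrt (2 * pi) * (- \<mu>3 / (6 * \<sigma>\<^sup>2) + d))"
  proof -
    have "(\<integral>w. ?G w \<partial>lborel)
        = 2 / b * (\<integral>w. ((- \<mu>3 / (6 * \<sigma>\<^sup>2)) * w\<^sup>2 + d) * exp (- w\<^sup>2 / 2) \<partial>lborel)"
      by (simp only: mult.assoc integral_mult_right_zero)
    then show ?thesis by (simp only: integral_quadratic_std_gaussian)
  qed
  ultimately have "(\<lambda>n. \<sigma> * sqrt (real (Suc n)) * (\<integral>t. inversion_integrand d (Suc n) t \<partial>lborel))
     \<longlonglongrightarrow> 2 / b * (sqrt (2 * pi) * (- \<mu>3 / (6 * \<sigma>\<^sup>2) + d))" by (simp only:)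
  then have "(\<lambda>n. \<sigma> * sqrt (real n) * (\<integral>t. inversion_integrand d n t \<partial>lborel))
     \<longlonglongrightarrow> 2 / b * (sqrt (2 * pi) * (- \<mu>3 / (6 * \<sigma>\<^sup>2) + d))"
    by (rule LIMSEQ_imp_Suc)
  then have "(\<lambda>n. b / (2 * pi * \<sigma>) * (\<sigma> * sqrt (real n) * (\<integral>t. inversion_integrand d n t \<partial>lborel)))
     \<longlonglongrightarrow> b / (2 * pi * \<sigma>) * (2 / b * (sqrt (2 * pi) * (- \<mu>3 / (6 * \<sigma>\<^sup>2) + d)))"
    by (rule tendsto_mult[OF tendsto_const])
  moreover have "b / (2 * pi * \<sigma>) * (\<sigma> * sqrt (real n) * x) = sqrt (real n) * (b / (2 * pi) * x)" for n x
    using sd_pos by simp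
  moreover have "b / (2 * pi * \<sigma>) * (2 / b * (sqrt (2 * pi) * (- \<mu>3 / (6 * \<sigma>\<^sup>2) + d)))
      = (2 * d / \<sigma> - \<mu>3 / (3 * \<sigma> ^ 3)) / sqrt (2 * pi)"
  proof -
    define r where "r = sqrt (2 * pi)"
    have r: "2 * pi = r * r" "r > 0" by (simp_all add: r_def)
    have "b / (2 * pi * \<sigma>) * (2 / b * (sqrt (2 * pi) * (- \<mu>3 / (6 * \<sigma>\<^sup>2) + d)))
      = 2 / \<sigma> * (- \<mu>3 / (6 * \<sigma>\<^sup>2) + d) / sqrt (2 * pi)"
      unfolding r_def[symmetric] r(1) using bpos sd_pos r(2) by simp
    also have "2 / \<sigma> * (- \<mu>3 / (6 * \<sigma>\<^sup>2) + d) = 2 * d / \<sigma> - \<mu>3 / (3 * \<sigma> ^ 3)"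
      using sd_pos by (simp add: field_simps power2_eq_square power3_eq_cube)
    finally show ?thesis .
  qed
  ultimately show ?thesis by simp
qed

end

section \<open>Bounded integer-valued random variables and their sums\<close>

context prob_space
begin

context
  fixes Z :: "'a \<Rightarrow> int" and B :: int
  assumes Z [measurable]: "Z \<in> measurable M (count_space UNIV)" and bounded: "AE \<omega> in M. \<bar>Z \<omega>\<bar> \<le> B"
begin

lemma rv_values_bounded: "rv_values M Z \<subseteq> {- B..B}"
proof
  fix x assume "x \<in> rv_values M Z"
  then have pos: "prob {\<omega> \<in> space M. Z \<omega> = x} > 0" by (simp add: rv_values_def)
  show "x \<in> {- B..B}"
  proof (rule ccontr)
    assume "x \<notin> {- B..B}"
    then have "AE \<omega> in M. \<omega> \<notin> {\<omega> \<in> space M. Z \<omega> = x}"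
      by (intro eventually_mono[OF bounded]) auto
    then have "prob {\<omega> \<in> space M. Z \<omega> = x} = 0" by (intro prob_eq_0[THEN iffD2]) auto
    with pos show False by simp
  qed
qed

lemma finite_rv_values: "finite (rv_values M Z)"
  by (rule finite_subset[OF rv_values_bounded]) simp

lemma AE_in_rv_values: "AE \<omega> in M. Z \<omega> \<in> rv_values M Z"
proof -
  have "AE \<omega> in M. \<forall>x\<in>{- B..B} - rv_values M Z. Z \<omega> \<noteq> x"
  proof (rule AE_finite_allI)
    fix x assume "x \<in> {- B..B} - rv_values M Z"
    then have "prob {\<omega> \<in> space M. Z \<omega> = x} = 0"
      by (simp add: rv_values_def zero_less_measure_iff)
    then have "AE \<omega> in M. \<omega> \<notin> {\<omega> \<in> space M. Z \<omega> = x}" by (subst (asm) prob_eq_0) auto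
    from eventually_conj[OF this AE_space] show "AE \<omega> in M. Z \<omega> \<noteq> x" by (rule eventually_mono) auto
  qed simp
  then show ?thesis using bounded by eventually_elim (auto simp: abs_le_iff)
qed

lemma expectation_rv_values:
  fixes f :: "int \<Rightarrow> 'b::{banach, second_countable_topology}"
  shows "has_bochner_integral M (\<lambda>\<omega>. f (Z \<omega>)) (\<Sum>x\<in>rv_values M Z. prob {\<omega> \<in> space M. Z \<omega> = x} *\<^sub>R f x)"
proof -
  have "has_bochner_integral M (\<lambda>\<omega>. \<Sum>x\<in>rv_values M Z. indicator {\<omega> \<in> space M. Z \<omega> = x} \<omega> *\<^sub>R f x)
      (\<Sum>x\<in>rv_values M Z. prob {\<omega> \<in> space M. Z \<omega> = x} *\<^sub>R f x)"
    by (intro has_bochner_integral_sum has_bochner_integral_scaleR_left has_bochner_integral_real_indicator)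
       (auto simp: less_top[symmetric])
  moreover have "AE \<omega> in M. (\<Sum>x\<in>rv_values M Z. indicator {\<omega> \<in> space M. Z \<omega> = x} \<omega> *\<^sub>R f x) = f (Z \<omega>)"
    using AE_in_rv_values AE_space
  proof eventually_elim
    case (elim \<omega>)
    then have "(\<Sum>x\<in>rv_values M Z. indicator {\<omega> \<in> space M. Z \<omega> = x} \<omega> *\<^sub>R f x)
       = (\<Sum>x\<in>rv_values M Z. if x = Z \<omega> then f x else 0)"
      by (intro sum.cong) (auto simp: indicator_def)
    then show ?case using elim finite_rv_values by simp
  qed
  ultimately show ?thesis
    by (subst has_bochner_integral_cong_AE[symmetric])
      (auto intro: borel_measurable_has_bochner_integral measurable_compose[OF Z])
qed

lemma tilt_eq_expectation_sgn:
  assumes "expectation (\<lambda>\<omega>. real_of_int (Z \<omega>)) = 0"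
  shows "tilt M (\<lambda>\<omega>. real_of_int (Z \<omega>)) = (\<Sum>x\<in>rv_values M Z. prob {\<omega> \<in> space M. Z \<omega> = x} * of_int (sgn x))"
proof -
  have "tilt M (\<lambda>\<omega>. real_of_int (Z \<omega>))
     = (\<integral>\<omega>. indicator {\<omega> \<in> space M. Z \<omega> > 0} \<omega> - indicator {\<omega> \<in> space M. Z \<omega> < 0} \<omega> \<partial>M)"
    unfolding tilt_def assms by (subst Bochner_Integration.integral_diff) (auto intro!: integrable_real_indicator simp: less_top[symmetric])
  also have "\<dots> = (\<integral>\<omega>. of_int (sgn (Z \<omega>)) \<partial>M)"
    by (intro Bochner_Integration.integral_cong) (auto simp: indicator_def sgn_if)
  also have "\<dots> = (\<Sum>x\<in>rv_values M Z. prob {\<omega> \<in> space M. Z \<omega> = x} * of_int (sgn x))"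
    using expectation_rv_values[of "\<lambda>x. of_int (sgn x) :: real"] by (simp add: has_bochner_integral_iff)
  finally show ?thesis .
qed

lemma finite_law_rv: "finite_law (rv_values M Z) (\<lambda>x. prob {\<omega> \<in> space M. Z \<omega> = x})"
proof
  show "finite (rv_values M Z)" by (rule finite_rv_values)
  show "prob {\<omega> \<in> space M. Z \<omega> = x} > 0" if "x \<in> rv_values M Z" for x using that by (simp add: rv_values_def)
  show "(\<Sum>x\<in>rv_values M Z. prob {\<omega> \<in> space M. Z \<omega> = x}) = 1"
    using expectation_rv_values[of "\<lambda>_. 1 :: real"] by (simp add: has_bochner_integral_iff prob_space)
qed

lemma cf_eq_expectation:
  "finite_law.cf (rv_values M Z) (\<lambda>x. prob {\<omega> \<in> space M. Z \<omega> = x}) t = (\<integral>\<omega>. cis (t * of_int (Z \<omega>)) \<partial>M)"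
  using expectation_rv_values[of "\<lambda>x. cis (t * of_int x)"]
  by (simp add: finite_law.cf_def[OF finite_law_rv] has_bochner_integral_iff scaleR_conv_of_real)

end

abbreviation power_space :: "nat \<Rightarrow> (nat \<Rightarrow> 'a) measure" where
  "power_space n \<equiv> (\<Pi>\<^sub>M i\<in>{..<n}. M)"

lemma prob_space_power_space: "prob_space (power_space n)"
  by (intro prob_space_PiM prob_space_axioms)

lemma AE_power_space:
  assumes "AE \<omega> in M. P \<omega>"
  shows "AE \<omega> in power_space n. \<forall>i<n. P (\<omega> i)"
proof -
  have "AE \<omega> in power_space n. \<forall>i\<in>{..<n}. P (\<omega> i)"
    by (intro AE_finite_allI AE_PiM_component) (use assms prob_space_axioms in auto)
  then show ?thesis by auto
qed

text \<open>
  Partial sums of the coordinates on the product space realise \<open>X[n]\<close>.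
\<close>

context
  fixes X :: "'a \<Rightarrow> int"
  assumes X [measurable]: "X \<in> measurable M (count_space UNIV)"
begin

abbreviation partial_sum :: "nat \<Rightarrow> (nat \<Rightarrow> 'a) \<Rightarrow> int" where
  "partial_sum n \<omega> \<equiv> (\<Sum>i<n. X (\<omega> i))"

text \<open>
  Measurability into the discrete space uses that the integers are countable: the sum is split
  according to the value of the first \<open>m\<close> terms.
\<close>

lemma measurable_partial_sum: "partial_sum n \<in> measurable (power_space n) (count_space UNIV)"
proof -
  have "(\<lambda>\<omega>. \<Sum>i<m. X (\<omega> i)) \<in> measurable (power_space n) (count_space UNIV)" if "m \<le> n" for m
    using that
  proof (induction m)
    case (Suc m)
    then have IH: "(\<lambda>\<omega>. \<Sum>i<m. X (\<omega> i)) \<in> measurable (power_space n) (count_space UNIV)" by simp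
    have "(\<lambda>\<omega>. j + X (\<omega> m)) \<in> measurable (power_space n) (count_space UNIV)" for j
    proof (rule measurable_compose[where g = "\<lambda>y. j + X y" and N = M])
      show "(\<lambda>\<omega>. \<omega> m) \<in> measurable (power_space n) M"
        using Suc.prems by (intro measurable_component_singleton) auto
    qed measurable
    from measurable_compose_countable[OF this IH] show ?case by simp
  qed simp
  then show ?thesis by simp
qed

lemma partial_sum_bounded:
  assumes "AE \<omega> in M. \<bar>X \<omega>\<bar> \<le> B"
  shows "AE \<omega> in power_space n. \<bar>partial_sum n \<omega>\<bar> \<le> int n * B"
  using AE_power_space[OF assms]
proof eventually_elim
  case (elim \<omega>)
  have "\<bar>partial_sum n \<omega>\<bar> \<le> (\<Sum>i<n. \<bar>X (\<omega> i)\<bar>)" by (rule sum_abs)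
  also have "\<dots> \<le> (\<Sum>i<n. B)" using elim by (intro sum_mono) auto
  finally show ?case by simp
qed

lemma partial_sum_lattice:
  assumes bounded: "AE \<omega> in M. \<bar>X \<omega>\<bar> \<le> B"
    and coset: "\<forall>x\<in>rv_values M X. [x = a] (mod b)" and x: "x \<in> rv_values (power_space n) (partial_sum n)"
  shows "[x = int n * a] (mod b)"
proof (rule ccontr)
  interpret P: prob_space "power_space n" by (rule prob_space_power_space)
  note [measurable] = measurable_partial_sum
  assume neq: "\<not> ?thesis"
  have "AE \<omega> in power_space n. \<forall>i<n. X (\<omega> i) \<in> rv_values M X"
    by (intro AE_power_space AE_in_rv_values[OF X bounded])
  then have "AE \<omega> in power_space n. \<omega> \<notin> {\<omega> \<in> space (power_space n). partial_sum n \<omega> = x}"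
  proof eventually_elim
    case (elim \<omega>)
    have "[partial_sum n \<omega> = (\<Sum>i<n. a)] (mod b)"
      by (intro cong_sum) (use elim coset in auto)
    then show ?case using neq by auto
  qed
  then have "P.prob {\<omega> \<in> space (power_space n). partial_sum n \<omega> = x} = 0"
    by (intro P.prob_eq_0[THEN iffD2]) auto
  then show False using x by (simp add: rv_values_def)
qed

lemma expectation_cis_partial_sum:
  "(\<integral>\<omega>. cis (t * of_int (partial_sum n \<omega>)) \<partial>power_space n) = (\<integral>\<omega>. cis (t * of_int (X \<omega>)) \<partial>M) ^ n"
proof -
  interpret product_sigma_finite "\<lambda>_. M" ..
  have "cis (t * of_int (partial_sum n \<omega>)) = (\<Prod>i<n. cis (t * of_int (X (\<omega> i))))" for \<omega>
    by (induction n) (auto simp: cis_mult[symmetric] distrib_left)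
  then have "(\<integral>\<omega>. cis (t * of_int (partial_sum n \<omega>)) \<partial>power_space n)
      = (\<integral>\<omega>. (\<Prod>i<n. cis (t * of_int (X (\<omega> i)))) \<partial>power_space n)" by simp
  also have "\<dots> = (\<Prod>i<n. \<integral>\<omega>. cis (t * of_int (X \<omega>)) \<partial>M)"
    by (intro product_integral_prod integrable_const_bound[of _ 1]) auto
  finally show ?thesis by simp
qed

lemma expectation_partial_sum:
  assumes bounded: "AE \<omega> in M. \<bar>X \<omega>\<bar> \<le> B" and mean: "expectation (\<lambda>\<omega>. real_of_int (X \<omega>)) = 0"
  shows "(\<integral>\<omega>. real_of_int (partial_sum n \<omega>) \<partial>power_space n) = 0"
proof -
  have int: "integrable M (\<lambda>\<omega>. real_of_int (X \<omega>))"
    using expectation_rv_values[OF X bounded, of real_of_int] by (simp add: has_bochner_integral_iff)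
  have comp: "distr (power_space n) M (\<lambda>\<omega>. \<omega> i) = M" if "i < n" for i
    using that by (intro distr_PiM_component prob_space_axioms) auto
  have "integrable (power_space n) (\<lambda>\<omega>. real_of_int (X (\<omega> i)))"
    and "(\<integral>\<omega>. real_of_int (X (\<omega> i)) \<partial>power_space n) = 0" if "i < n" for i
  proof -
    have m: "(\<lambda>\<omega>. \<omega> i) \<in> measurable (power_space n) M" using that by (intro measurable_component_singleton) auto
    show "integrable (power_space n) (\<lambda>\<omega>. real_of_int (X (\<omega> i)))"
      using int comp[OF that] by (intro integrable_distr[OF m, where f = "\<lambda>\<omega>. real_of_int (X \<omega>)"]) simp
    show "(\<integral>\<omega>. real_of_int (X (\<omega> i)) \<partial>power_space n) = 0"
      using integral_distr[OF m, of "\<lambda>\<omega>. real_of_int (X \<omega>)"] comp[OF that] mean by simp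
  qed
  then show ?thesis by (simp add: Bochner_Integration.integral_sum)
qed

end

end

section \<open>Asymptotics of the tilt\<close>

text \<open>
  Among the points congruent to \<open>c\<close>, the residue \<open>c mod b\<close> is the least nonnegative one and
  \<open>b - (-c mod b)\<close> the least positive one. They coincide unless \<open>b\<close> divides \<open>c\<close>; in that case they
  are \<open>0\<close> and \<open>b\<close>, and averaging gives the value \<open>0\<close> at the origin.
\<close>

lemma sgn_eq_threshold_mean:
  fixes x c b :: int
  assumes b: "b > 0" and cong: "[x = c] (mod b)"
  shows "real_of_int (sgn x) = ((if c mod b \<le> x then 1 else - 1) + (if b - (- c) mod b \<le> x then 1 else - 1)) / 2"
proof -
  have "c mod b = x mod b" using cong by (simp add: cong_def)
  then have "c mod b \<le> x \<longleftrightarrow> 0 \<le> x"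
    using b pos_mod_sign[of b x] zmod_le_nonneg_dividend[of x b] by (simp, linarith)
  moreover have "b - (- c) mod b \<le> x \<longleftrightarrow> 0 < x"
  proof
    assume "0 < x"
    have "(x + (- c) mod b) mod b = (x - c) mod b" using mod_add_right_eq[of x "- c" b] by simp
    also have "\<dots> = 0" using cong by (simp add: cong_iff_dvd_diff)
    finally have "b dvd x + (- c) mod b" by (simp only: dvd_eq_mod_eq_0)
    moreover have "0 < x + (- c) mod b" using \<open>0 < x\<close> b by (simp add: add_pos_nonneg)
    ultimately have "b \<le> x + (- c) mod b" by (rule zdvd_imp_le)
    then show "b - (- c) mod b \<le> x" by simp
  next
    assume "b - (- c) mod b \<le> x"
    moreover have "(- c) mod b < b" using b by simp
    ultimately show "0 < x" by linarith
  qed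
  ultimately show ?thesis by (auto simp: sgn_if)
qed

text \<open>
  A modulus for which all values are congruent divides the difference of two distinct values, so the
  moduli are bounded and the greatest one exists.
\<close>

lemma rv_span_properties:
  assumes xy: "x \<in> rv_values M X" "y \<in> rv_values M X" "x \<noteq> y"
  shows "rv_span M X > 0"
    and "\<forall>z\<in>rv_values M X. [z = a] (mod g) \<Longrightarrow> g \<le> rv_span M X"
proof -
  define P where "P g \<longleftrightarrow> (\<exists>a. \<forall>z\<in>rv_values M X. [z = a] (mod g))" for g
  have bound: "g \<le> \<bar>x - y\<bar>" if "P g" for g
  proof -
    from that xy have "[x = y] (mod g)" unfolding P_def by (meson cong_sym cong_trans)
    then have "g dvd x - y" by (simp add: cong_iff_dvd_diff)
    then have "\<bar>g\<bar> \<le> \<bar>x - y\<bar>" using xy(3) by (intro dvd_imp_le_int) auto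
    then show ?thesis by simp
  qed
  \<comment> \<open>nonpositive moduli never exceed the modulus \<open>1\<close>, so the maximum may be sought among positive ones\<close>
  define m where "m = Max {g \<in> {1..\<bar>x - y\<bar>}. P g}"
  have fin: "finite {g \<in> {1..\<bar>x - y\<bar>}. P g}" by (rule finite_subset[of _ "{1..\<bar>x - y\<bar>}"]) auto
  have one: "1 \<in> {g \<in> {1..\<bar>x - y\<bar>}. P g}" using bound[of 1] by (auto simp: P_def)
  have m: "m \<in> {g \<in> {1..\<bar>x - y\<bar>}. P g}" unfolding m_def using fin one by (intro Max_in) auto
  have max: "g \<le> m" if "P g" for g
  proof (cases "g \<ge> 1")
    case True
    then show ?thesis unfolding m_def using fin bound[OF that] that by (intro Max_ge) auto
  qed (use m in auto)
  have span: "rv_span M X = m"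
    unfolding rv_span_def P_def[symmetric] using m max by (intro Greatest_equality) auto
  show "rv_span M X > 0" using m by (simp add: span)
  show "g \<le> rv_span M X" if "\<forall>z\<in>rv_values M X. [z = a] (mod g)"
    unfolding span by (rule max) (use that in \<open>auto simp: P_def\<close>)
qed

lemma (in prob_space) centred_law_rv:
  fixes X :: "'a \<Rightarrow> int"
  assumes X: "X \<in> measurable M (count_space UNIV)" and bounded: "AE \<omega> in M. \<bar>X \<omega>\<bar> \<le> B"
    and two: "x \<in> rv_values M X" "y \<in> rv_values M X" "x \<noteq> y"
    and mean: "expectation (\<lambda>\<omega>. real_of_int (X \<omega>)) = 0"
  shows "centred_law (rv_values M X) (\<lambda>x. prob {\<omega> \<in> space M. X \<omega> = x}) (rv_span M X)
    (sqrt (variance (\<lambda>\<omega>. real_of_int (X \<omega>)))) (expectation (\<lambda>\<omega>. real_of_int (X \<omega>) ^ 3))"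
proof -
  let ?V = "rv_values M X" and ?p = "\<lambda>x. prob {\<omega> \<in> space M. X \<omega> = x}"
  interpret finite_law ?V ?p by (rule finite_law_rv[OF X bounded])
  have E: "expectation (\<lambda>\<omega>. f (X \<omega>)) = (\<Sum>x\<in>?V. ?p x * f x)" for f :: "int \<Rightarrow> real"
    using expectation_rv_values[OF X bounded, of f] by (simp add: has_bochner_integral_iff)
  have var: "variance (\<lambda>\<omega>. real_of_int (X \<omega>)) = (\<Sum>x\<in>?V. ?p x * (real_of_int x)\<^sup>2)"
    using E[of "\<lambda>x. (real_of_int x)\<^sup>2"] by (simp add: mean)
  obtain z where z: "z \<in> ?V" "z \<noteq> 0" using two by (cases "x = 0") auto
  have "(\<Sum>x\<in>?V. ?p x * (real_of_int x)\<^sup>2) > 0"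
    using z fin pos by (intro sum_pos2[of _ z]) auto
  then have var_pos: "variance (\<lambda>\<omega>. real_of_int (X \<omega>)) > 0" by (simp only: var)
  show ?thesis
  proof
    show "(\<Sum>x\<in>?V. ?p x * real_of_int x) = 0" using E[of real_of_int] mean by simp
    show "(sqrt (variance (\<lambda>\<omega>. real_of_int (X \<omega>))))\<^sup>2 = (\<Sum>x\<in>?V. ?p x * (real_of_int x)\<^sup>2)"
      using var_pos var by (simp only: real_sqrt_pow2 less_imp_le)
    show "sqrt (variance (\<lambda>\<omega>. real_of_int (X \<omega>))) > 0" using var_pos by (simp only: real_sqrt_gt_0_iff)
    show "expectation (\<lambda>\<omega>. real_of_int (X \<omega>) ^ 3) = (\<Sum>x\<in>?V. ?p x * real_of_int x ^ 3)"
      using E[of "\<lambda>x. real_of_int x ^ 3"] by simp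
    show "rv_span M X > 0" by (rule rv_span_properties(1)[OF two])
    show "g \<le> rv_span M X" if "\<forall>x\<in>?V. [x = a] (mod g)" for g a
      using that by (rule rv_span_properties(2)[OF two])
  qed
qed

text \<open>
  By independence the Fourier transform of the law of the sum is the \<open>n\<close>-th power of that of \<open>X\<close>, so
  both threshold functions whose average is \<open>sgn\<close> on the coset can be inverted exactly.
\<close>

lemma (in prob_space) tilt_sum_inversion:
  fixes X :: "'a \<Rightarrow> int"
  assumes X: "X \<in> measurable M (count_space UNIV)" and bounded: "AE \<omega> in M. \<bar>X \<omega>\<bar> \<le> B"
    and centred: "expectation (\<lambda>\<omega>. real_of_int (X \<omega>)) = 0"
    and law: "centred_law (rv_values M X) (\<lambda>x. prob {\<omega> \<in> space M. X \<omega> = x}) b \<sigma> \<mu>3"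
    and shift: "\<forall>x\<in>rv_values M X. [x = a] (mod b)"
  defines "I d n \<equiv> b / (2 * pi) * (\<integral>t. centred_law.inversion_integrand (rv_values M X) (\<lambda>x. prob {\<omega> \<in> space M. X \<omega> = x}) b d n t \<partial>lborel)"
  shows "tilt_sum M X n = (I (b / 2 - real_of_int ((int n * a) mod b)) n
     + I (b / 2 - real_of_int (b - (- (int n * a)) mod b)) n) / 2"
proof -
  interpret centred_law "rv_values M X" "\<lambda>x. prob {\<omega> \<in> space M. X \<omega> = x}" b \<sigma> \<mu>3 by (rule law)
  let ?N = "\<Pi>\<^sub>M i\<in>{..<n}. M" and ?S = "\<lambda>\<omega>. \<Sum>i<n. X (\<omega> i)"
  let ?W = "rv_values ?N ?S" and ?q = "\<lambda>x. measure ?N {\<omega> \<in> space ?N. ?S \<omega> = x}"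
  let ?c1 = "(int n * a) mod b" and ?c2 = "b - (- (int n * a)) mod b"
  interpret N: prob_space ?N by (rule prob_space_power_space)
  note S = measurable_partial_sum[OF X, of n] and S_bounded = partial_sum_bounded[OF X bounded, of n]
  have lattice: "[x = int n * a] (mod b)" if "x \<in> ?W" for x
    by (rule partial_sum_lattice[OF X bounded shift that])
  have cf_power: "cf t ^ n = (\<Sum>x\<in>?W. of_real (?q x) * cis (t * of_int x))" for t
  proof -
    have "cf t ^ n = (\<integral>\<omega>. cis (t * of_int (?S \<omega>)) \<partial>?N)"
      by (simp only: cf_eq_expectation[OF X bounded] expectation_cis_partial_sum[OF X])
    also have "\<dots> = (\<Sum>x\<in>?W. of_real (?q x) * cis (t * of_int x))"
      using N.expectation_rv_values[OF S S_bounded, of "\<lambda>x. cis (t * of_int x)"]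
      by (simp only: has_bochner_integral_iff scaleR_conv_of_real)
    finally show ?thesis .
  qed
  have threshold: "(\<Sum>x\<in>?W. ?q x * (if c \<le> x then 1 else - 1)) = I (b / 2 - c) n"
    if "[int n * a = c] (mod b)" for c
    unfolding I_def inversion_integrand_def
    by (rule lattice_threshold_inversion[OF N.finite_rv_values[OF S S_bounded] span_pos _ cf_power])
       (use lattice that in \<open>blast intro: cong_trans\<close>)
  have "tilt_sum M X n = (\<Sum>x\<in>?W. ?q x * of_int (sgn x))"
    unfolding tilt_sum_def
    by (rule N.tilt_eq_expectation_sgn[OF S S_bounded expectation_partial_sum[OF X bounded centred]])
  also have "\<dots> = (\<Sum>x\<in>?W. (?q x * (if ?c1 \<le> x then 1 else - 1) + ?q x * (if ?c2 \<le> x then 1 else - 1)) / 2)"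
    by (intro sum.cong refl)
       (simp only: sgn_eq_threshold_mean[OF span_pos lattice] distrib_left times_divide_eq_right)
  also have "\<dots> = (I (b / 2 - ?c1) n + I (b / 2 - ?c2) n) / 2"
  proof -
    have "[int n * a = ?c1] (mod b)" "[int n * a = ?c2] (mod b)"
      by (simp_all add: cong_def mod_simps)
    from this[THEN threshold] show ?thesis
      by (simp only: sum_divide_distrib[symmetric] sum.distrib)
  qed
  finally show ?thesis .
qed

theorem theorem1:
  fixes M :: "'a measure" and X :: "'a \<Rightarrow> int" and a b :: int and \<sigma> \<mu>3 :: real
  assumes "prob_space M"
    and "X \<in> measurable M (count_space UNIV)"
    and "\<exists>B. AE \<omega> in M. \<bar>X \<omega>\<bar> \<le> B"
    and "\<exists>x\<in>rv_values M X. \<exists>y\<in>rv_values M X. x \<noteq> y"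
    and "prob_space.expectation M (\<lambda>\<omega>. real_of_int (X \<omega>)) = 0"
    and "\<sigma> = sqrt (prob_space.variance M (\<lambda>\<omega>. real_of_int (X \<omega>)))"
    and "\<mu>3 = prob_space.expectation M (\<lambda>\<omega>. real_of_int (X \<omega>) ^ 3)"
    and "b = rv_span M X"
    and "is_shift M X a"
  shows "\<exists>E :: nat \<Rightarrow> real.
           (\<forall>n\<ge>1. tilt_sum M X n = L_term b \<sigma> \<mu>3 (int n * a) / sqrt (2 * pi * real n) + E n) \<and>
           E \<in> o(\<lambda>n. 1 / sqrt (real n))"
proof -
  interpret prob_space M by (rule assms(1))
  note X = assms(2) and centred = assms(5)
  obtain B where bounded: "AE \<omega> in M. \<bar>X \<omega>\<bar> \<le> B" using assms(3) by blast
  have shift: "\<forall>x\<in>rv_values M X. [x = a] (mod b)"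
    using assms(8,9) by (simp add: is_shift_def)
  have law: "centred_law (rv_values M X) (\<lambda>x. prob {\<omega> \<in> space M. X \<omega> = x}) b \<sigma> \<mu>3"
    using assms(4) centred_law_rv[OF X bounded _ _ _ centred] unfolding assms(6,7,8) by blast
  interpret centred_law "rv_values M X" "\<lambda>x. prob {\<omega> \<in> space M. X \<omega> = x}" b \<sigma> \<mu>3 by (rule law)
  define I where "I d n = b / (2 * pi) * (\<integral>t. inversion_integrand d n t \<partial>lborel)" for d n
  define leading where "leading d = (2 * d / \<sigma> - \<mu>3 / (3 * \<sigma> ^ 3)) / sqrt (2 * pi)" for d
  define G where "G d n = sqrt (real n) * I d n - leading d" for d n
  define d1 where "d1 n = b / 2 - real_of_int ((int n * a) mod b)" for n
  define d2 where "d2 n = b / 2 - real_of_int (b - (- (int n * a)) mod b)" for n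
  define E where "E n = tilt_sum M X n - L_term b \<sigma> \<mu>3 (int n * a) / sqrt (2 * pi * real n)" for n
  have G0: "G d \<longlonglongrightarrow> 0" for d
    using tendsto_diff[OF inversion_integral_limit[of d] tendsto_const[of "leading d"]]
    by (simp add: G_def[abs_def] I_def leading_def)
  \<comment> \<open>both thresholds lie in \<open>{0..b}\<close>, so the shifts take finitely many values\<close>
  let ?D = "(\<lambda>c. b / 2 - real_of_int c) ` {0..b}"
  have "d1 n \<in> ?D" for n
    unfolding d1_def by (rule imageI) (use span_pos in \<open>simp add: less_imp_le\<close>)
  then have lim1: "(\<lambda>n. G (d1 n) n) \<longlonglongrightarrow> 0"
    by (rule tendsto_selection_finite[of ?D G d1, rotated 2]) (simp_all add: G0)
  have "d2 n \<in> ?D" for n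
    unfolding d2_def by (rule imageI) (use span_pos in \<open>simp add: less_imp_le\<close>)
  then have lim2: "(\<lambda>n. G (d2 n) n) \<longlonglongrightarrow> 0"
    by (rule tendsto_selection_finite[of ?D G d2, rotated 2]) (simp_all add: G0)
  from tendsto_divide[OF tendsto_add[OF lim1 lim2] tendsto_const[of 2]]
  have "(\<lambda>n. (G (d1 n) n + G (d2 n) n) / 2) \<longlonglongrightarrow> 0" by simp
  moreover have "(G (d1 n) n + G (d2 n) n) / 2 = E n / (1 / sqrt (real n))" if "n > 0" for n
  proof -
    have "(leading x + leading y) / 2 = ((x + y) / \<sigma> - \<mu>3 / (3 * \<sigma> ^ 3)) / sqrt (2 * pi)" for x y
      unfolding leading_def by (simp add: add_divide_distrib diff_divide_distrib)
    moreover have "d1 n + d2 n = real_of_int ((- (int n * a)) mod b - (int n * a) mod b)"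
      by (simp add: d1_def d2_def)
    ultimately have mean_leading:
      "(leading (d1 n) + leading (d2 n)) / 2 = L_term b \<sigma> \<mu>3 (int n * a) / sqrt (2 * pi)"
      by (simp only: L_term_def)
    have T: "tilt_sum M X n = (I (d1 n) n + I (d2 n) n) / 2"
      unfolding d1_def d2_def I_def by (rule tilt_sum_inversion[OF X bounded centred law shift])
    have avg: "(s * x - p + (s * y - q)) / 2 = s * ((x + y) / 2) - (p + q) / 2" for s x y p q :: real
      by (simp add: field_simps)
    have "(G (d1 n) n + G (d2 n) n) / 2 = sqrt (real n) * tilt_sum M X n - L_term b \<sigma> \<mu>3 (int n * a) / sqrt (2 * pi)"
      by (simp only: G_def avg T mean_leading)
    also have "\<dots> = sqrt (real n) * E n"
      using that unfolding E_def real_sqrt_mult[of "2 * pi"] right_diff_distrib by simp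
    also have "\<dots> = E n / (1 / sqrt (real n))" by simp
    finally show ?thesis .
  qed
  then have "\<forall>\<^sub>F n in sequentially. (G (d1 n) n + G (d2 n) n) / 2 = E n / (1 / sqrt (real n))"
    by (intro eventually_mono[OF eventually_gt_at_top[of 0]])
  ultimately have "(\<lambda>n. E n / (1 / sqrt (real n))) \<longlonglongrightarrow> 0"
    by (simp only: filterlim_cong)
  moreover have "\<forall>\<^sub>F n in sequentially. 1 / sqrt (real n) \<noteq> 0"
    using eventually_gt_at_top[of 0] by eventually_elim simp
  ultimately have "E \<in> o(\<lambda>n. 1 / sqrt (real n))" by (rule smalloI_tendsto)
  then show ?thesis by (intro exI[of _ E]) (simp add: E_def)
qed

end
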